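(* Let $G$ be a directed graph in which each vertex has finite in-degree. Then the graph inverse semigroup $P_G$ is pre-Boolean.
   Context: Graph inverse semigroup. Let $G$ be a directed graph and $G^*$ the free category on $G$; its arrows are the paths in $G$ (including an empty path at each vertex). Each arrow $a$ has a domain $\mathbf{d}(a)$ and codomain $\mathbf{r}(a)$, and a product $ab$ is defined iff $\mathbf{d}(a)=\mathbf{r}(b)$. The in-degree of a vertex $v$ is the number of edges $a$ with $\mathbf{r}(a)=v$. The elements of $P_G$ are a zero together with the symbols $xy^{-1}$ where $x,y$ are paths with $\mathbf{d}(x)=\mathbf{d}(y)$. The product of non-zero elements is: $xy^{-1}\cdot uv^{-1}=xzv^{-1}$ if $u=yz$ for some path $z$; $=x(vz)^{-1}$ if $y=uz$ for some path $z$; and $=0$ otherwise. $P_G$ is an inverse semigroup with zero, $(xy^{-1})^{-1}=yx^{-1}$, and each pair of elements has a meet in the natural partial order ($s\le t$ iff $s=te$ for some idempotent $e$; concretely $xy^{-1}\le uv^{-1}$ iff $x=up$, $y=vp$ for some path $p$). Pre-Boolean. Let $S$ be an inverse $\wedge$-semigroup, i.e. an inverse semigroup with zero in which each pair of elements has a meet in the natural partial order. Elements $s,t$ are compatible if $s^{-1}t$ and $st^{-1}$ are idempotents. Write $\{a_1,\ldots,a_m\}\rightarrow\{b_1,\ldots,b_k\}$ if for each $i$ and each non-zero $x\le a_i$ there is $j$ with $x\wedge b_j\ne0$; $\leftrightarrow$ means both directions. On elements, $\leftrightarrow$ is a congruence on $S$; put $\mathbf{S}=S/\!\leftrightarrow$,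 again an inverse $\wedge$-semigroup. Let $\mathsf{FC}(\mathbf{S})$ be the inverse semigroup, under multiplication of subsets, of all order ideals $\{a_1,\ldots,a_m\}^{\downarrow}$ of $\mathbf{S}$ generated by non-empty finite pairwise compatible subsets. Define $\{a_1,\ldots,a_m\}^\downarrow\equiv\{b_1,\ldots,b_k\}^\downarrow$ iff $\{a_1,\ldots,a_m\}\leftrightarrow\{b_1,\ldots,b_k\}$ in $\mathbf{S}$, a congruence. The distributive completion is $\mathsf{D}(S)=\mathsf{FC}(\mathbf{S})/\!\equiv$. It is always distributive: every finite non-empty compatible subset has a join and multiplication distributes over such joins. $S$ is pre-Boolean if $\mathsf{D}(S)$ is Boolean, meaning that its semilattice of idempotents is a generalized Boolean algebra (distributive lattice with $0$ and relative complements, a top not being required). *)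

theory Defs
  imports "HOL-Algebra.Lattice" "Graph_Theory.Arc_Walk"
begin

section \<open>Inverse semigroups with zero\<close>

record 'a zero_semigroup = "'a partial_object" +
  sg_mult :: "'a \<Rightarrow> 'a \<Rightarrow> 'a" (infixl \<open>\<cdot>\<index>\<close> 70)
  sg_zero :: 'a (\<open>\<o>\<index>\<close>)

definition idempotents :: "('a, 'm) zero_semigroup_scheme \<Rightarrow> 'a set" where
  "idempotents S = {e \<in> carrier S. e \<cdot>\<^bsub>S\<^esub> e = e}"

locale inverse_semigroup_zero =
  fixes S (structure)
  assumes mult_closed: "\<lbrakk>s \<in> carrier S; t \<in> carrier S\<rbrakk> \<Longrightarrow> s \<cdot> t \<in> carrier S"
    and mult_assoc: "\<lbrakk>s \<in> carrier S; t \<in> carrier S; u \<in> carrier S\<rbrakk> \<Longrightarrow> (s \<cdot> t) \<cdot> u = s \<cdot> (t \<cdot> u)"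
    and zero_closed: "\<o> \<in> carrier S"
    and zero_left: "s \<in> carrier S \<Longrightarrow> \<o> \<cdot> s = \<o>"
    and zero_right: "s \<in> carrier S \<Longrightarrow> s \<cdot> \<o> = \<o>"
    and unique_inverse:
      "s \<in> carrier S \<Longrightarrow> \<exists>!t. t \<in> carrier S \<and> s \<cdot> t \<cdot> s = s \<and> t \<cdot> s \<cdot> t = t"

definition sg_inverse :: "('a, 'm) zero_semigroup_scheme \<Rightarrow> 'a \<Rightarrow> 'a" where
  "sg_inverse S s =
     (THE t. t \<in> carrier S \<and> s \<cdot>\<^bsub>S\<^esub> t \<cdot>\<^bsub>S\<^esub> s = s \<and> t \<cdot>\<^bsub>S\<^esub> s \<cdot>\<^bsub>S\<^esub> t = t)"

definition nat_le :: "('a, 'm) zero_semigroup_scheme \<Rightarrow> 'a \<Rightarrow> 'a \<Rightarrow> bool" where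
  "nat_le S s t \<longleftrightarrow>
     s \<in> carrier S \<and> t \<in> carrier S \<and> (\<exists>e \<in> idempotents S. s = t \<cdot>\<^bsub>S\<^esub> e)"

definition natural_order :: "('a, 'm) zero_semigroup_scheme \<Rightarrow> 'a gorder" where
  "natural_order S = \<lparr>carrier = carrier S, eq = (=), le = nat_le S\<rparr>"

definition idempotent_order :: "('a, 'm) zero_semigroup_scheme \<Rightarrow> 'a gorder" where
  "idempotent_order S = \<lparr>carrier = idempotents S, eq = (=), le = nat_le S\<rparr>"

locale inverse_meet_semigroup = inverse_semigroup_zero S for S (structure) +
  assumes meet_exists:
    "\<lbrakk>s \<in> carrier S; t \<in> carrier S\<rbrakk> \<Longrightarrow>
       \<exists>m. greatest (natural_order S) m (Lower (natural_order S) {s, t})"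

definition compatible :: "('a, 'm) zero_semigroup_scheme \<Rightarrow> 'a \<Rightarrow> 'a \<Rightarrow> bool" where
  "compatible S s t \<longleftrightarrow>
     sg_inverse S s \<cdot>\<^bsub>S\<^esub> t \<in> idempotents S \<and> s \<cdot>\<^bsub>S\<^esub> sg_inverse S t \<in> idempotents S"

text \<open>Every interval has complements; a top element is not required.\<close>

locale generalized_boolean_algebra = Lattice.lattice L for L (structure) +
  assumes bottom_exists: "\<exists>b. least L b (carrier L)"
    and meet_join_distrib:
      "\<lbrakk>x \<in> carrier L; y \<in> carrier L; z \<in> carrier L\<rbrakk> \<Longrightarrow> x \<sqinter> (y \<squnion> z) = (x \<sqinter> y) \<squnion> (x \<sqinter> z)"
    and relative_complement:
      "\<lbrakk>x \<in> carrier L; y \<in> carrier L; z \<in> carrier L; x \<sqsubseteq> y; y \<sqsubseteq> z\<rbrakk> \<Longrightarrow>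
         \<exists>c \<in> carrier L. y \<sqinter> c = x \<and> y \<squnion> c = z"

locale boolean_inverse_semigroup = inverse_semigroup_zero S for S (structure) +
  assumes idempotents_boolean: "generalized_boolean_algebra (idempotent_order S)"


section \<open>The distributive completion\<close>

definition arrow :: "('a, 'm) zero_semigroup_scheme \<Rightarrow> 'a set \<Rightarrow> 'a set \<Rightarrow> bool" where
  "arrow S A B \<longleftrightarrow>
     (\<forall>a \<in> A. \<forall>x. nat_le S x a \<and> x \<noteq> \<o>\<^bsub>S\<^esub> \<longrightarrow> (\<exists>b \<in> B. x \<sqinter>\<^bsub>natural_order S\<^esub> b \<noteq> \<o>\<^bsub>S\<^esub>))"

definition biarrow :: "('a, 'm) zero_semigroup_scheme \<Rightarrow> 'a set \<Rightarrow> 'a set \<Rightarrow> bool" where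
  "biarrow S A B \<longleftrightarrow> arrow S A B \<and> arrow S B A"

definition quotient_semigroup ::
    "('a, 'm) zero_semigroup_scheme \<Rightarrow> ('a \<times> 'a) set \<Rightarrow> 'a set zero_semigroup" where
  "quotient_semigroup S R =
     \<lparr>carrier = carrier S // R,
      sg_mult = (\<lambda>X Y. \<Union>x \<in> X. \<Union>y \<in> Y. R `` {x \<cdot>\<^bsub>S\<^esub> y}),
      sg_zero = R `` {\<o>\<^bsub>S\<^esub>}\<rparr>"

definition biarrow_rel :: "('a, 'm) zero_semigroup_scheme \<Rightarrow> ('a \<times> 'a) set" where
  "biarrow_rel S = {(a, b). a \<in> carrier S \<and> b \<in> carrier S \<and> biarrow S {a} {b}}"

definition biarrow_quotient :: "('a, 'm) zero_semigroup_scheme \<Rightarrow> 'a set zero_semigroup" where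
  "biarrow_quotient S = quotient_semigroup S (biarrow_rel S)"

definition down_closure :: "('a, 'm) zero_semigroup_scheme \<Rightarrow> 'a set \<Rightarrow> 'a set" where
  "down_closure S A = {x. \<exists>a \<in> A. nat_le S x a}"

definition fin_compatible_sets :: "('a, 'm) zero_semigroup_scheme \<Rightarrow> 'a set set" where
  "fin_compatible_sets S =
     {A. A \<subseteq> carrier S \<and> finite A \<and> A \<noteq> {} \<and> (\<forall>a \<in> A. \<forall>b \<in> A. compatible S a b)}"

definition FC :: "('a, 'm) zero_semigroup_scheme \<Rightarrow> 'a set zero_semigroup" where
  "FC S =
     \<lparr>carrier = down_closure S ` fin_compatible_sets S,
      sg_mult = (\<lambda>X Y. {x \<cdot>\<^bsub>S\<^esub> y | x y. x \<in> X \<and> y \<in> Y}),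
      sg_zero = down_closure S {\<o>\<^bsub>S\<^esub>}\<rparr>"

definition FC_rel :: "('a, 'm) zero_semigroup_scheme \<Rightarrow> ('a set \<times> 'a set) set" where
  "FC_rel S =
     {(down_closure S A, down_closure S B) | A B.
        A \<in> fin_compatible_sets S \<and> B \<in> fin_compatible_sets S \<and> biarrow S A B}"

definition distributive_completion ::
    "('a, 'm) zero_semigroup_scheme \<Rightarrow> 'a set set set zero_semigroup" where
  "distributive_completion S =
     quotient_semigroup (FC (biarrow_quotient S)) (FC_rel (biarrow_quotient S))"

definition pre_boolean :: "('a, 'm) zero_semigroup_scheme \<Rightarrow> bool" where
  "pre_boolean S \<longleftrightarrow>
     inverse_meet_semigroup S \<and> boolean_inverse_semigroup (distributive_completion S)"


section \<open>Graph inverse semigroups\<close>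

text \<open>
  An arrow of the free category is a triple of its domain, its list of edges and its codomain.
  Edges go from their tail (domain) to their head (codomain), and an \<^const>\<open>pre_digraph.awalk\<close>
  lists them in the order in which they are traversed. Products are composed from right to left,
  so the edges of \<open>z\<close> come before those of \<open>x\<close> in the edge list of the product \<open>xz\<close>.
\<close>

type_synonym ('v, 'e) path = "'v \<times> 'e list \<times> 'v"

definition paths :: "('v, 'e) pre_digraph \<Rightarrow> ('v, 'e) path set" where
  "paths G = {(u, p, v). pre_digraph.awalk G u p v}"

fun pdom :: "('v, 'e) path \<Rightarrow> 'v" where
  "pdom (u, p, v) = u"

fun pcod :: "('v, 'e) path \<Rightarrow> 'v" where
  "pcod (u, p, v) = v"

text \<open>Only meaningful when \<open>pdom x = pcod z\<close>.\<close>

fun pcomp :: "('v, 'e) path \<Rightarrow> ('v, 'e) path \<Rightarrow> ('v, 'e) path" where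
  "pcomp (u, p, v) (u', q, v') = (u', q @ p, v)"

definition extends_by :: 
    "('v, 'e) pre_digraph \<Rightarrow> ('v, 'e) path \<Rightarrow> ('v, 'e) path \<Rightarrow> ('v, 'e) path \<Rightarrow> bool" where
  "extends_by G u y z \<longleftrightarrow> z \<in> paths G \<and> pdom y = pcod z \<and> u = pcomp y z"

text \<open>\<open>Frac x y\<close> is the symbol $xy^{-1}$.\<close>

datatype ('v, 'e) gis = Null | Frac "('v, 'e) path" "('v, 'e) path"

text \<open>The path \<open>z\<close> below is unique by cancellation, and if both cases apply it is empty.\<close>

fun gis_mult ::
    "('v, 'e) pre_digraph \<Rightarrow> ('v, 'e) gis \<Rightarrow> ('v, 'e) gis \<Rightarrow> ('v, 'e) gis" where
  "gis_mult G (Frac x y) (Frac u v) =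
     (if \<exists>z. extends_by G u y z then Frac (pcomp x (THE z. extends_by G u y z)) v
      else if \<exists>z. extends_by G y u z then Frac x (pcomp v (THE z. extends_by G y u z))
      else Null)"
| "gis_mult G Null t = Null"
| "gis_mult G s Null = Null"

definition graph_inverse_semigroup ::
    "('v, 'e) pre_digraph \<Rightarrow> ('v, 'e) gis zero_semigroup" where
  "graph_inverse_semigroup G =
     \<lparr>carrier = {Null} \<union> {Frac x y | x y. x \<in> paths G \<and> y \<in> paths G \<and> pdom x = pdom y},
      sg_mult = gis_mult G,
      sg_zero = Null\<rparr>"

end

theory Submission
  imports Defs
begin

text \<open>
  Let a boundary ray be a backward sequence of arcs that is infinite or ends in a vertex without
  incoming arcs. Prefixing makes $P_G$ act on pairs of a boundary ray and an integer: the symbol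
  $xy^{-1}$ sends $(yw, n + |y|)$ to $(xw, n + |x|)$. Two finite sets satisfy
  $A \rightarrow B$ iff the union of the partial injections of $A$ is contained in that of $B$, so
  the distributive completion is faithfully represented by the finite compatible unions of these
  partial injections, with inclusion as the natural order, and its idempotents form a collection of
  sets closed under unions. Finiteness of the in-degrees makes this collection closed under
  differences as well: the rays through $y$ that do not pass through a given arc $a$ after $y$ are
  the union of the finitely many cylinders of $yb$ with $b \ne a$.
\<close>

section \<open>Representations by partial injections\<close>

text \<open>The action on boundary rays alone cannot describe $P_G$: if a is the only arc into the
  domain of x, then xx^-1 and xa(xa)^-1 move the same boundary rays. Yet the inverse, the natural
  order and the meets behind \<rightarrow> are those of $P_G$ itself. So two actions run side by
  side. Arbitrary sequences, which may stop anywhere, separate all symbols; boundary rays separate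
  exactly what \<leftrightarrow> separates. A sequence that stops at a vertex with incoming arcs
  would be a point of the cylinder of y missed by every cylinder of yb, which is why such sequences
  are not boundary rays.

  The other obstacle is the shape of the completion, a quotient of a semigroup of ideals of a
  quotient, whose elements are sets of sets of sets of symbols. No normal form for them is computed.
  A map to relations is carried through each of the three constructions by taking unions; both
  congruences turn out to be kernels of such maps, so the last map is injective. Associativity,
  inverses, order and idempotents of the completion are then read off from relations.\<close>

definition partial_injection :: "'x rel \<Rightarrow> bool" where
  "partial_injection r \<longleftrightarrow> single_valued r \<and> single_valued (r\<inverse>)"

lemma partial_injectionI:
  assumes "\<And>a b c. (a, b) \<in> r \<Longrightarrow> (a, c) \<in> r \<Longrightarrow> b = c"
    and "\<And>a b c. (a, c) \<in> r \<Longrightarrow> (b, c) \<in> r \<Longrightarrow> a = b"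
  shows "partial_injection r"
  unfolding partial_injection_def single_valued_def using assms by blast

lemma partial_injection_right: "partial_injection r \<Longrightarrow> (a, b) \<in> r \<Longrightarrow> (a, c) \<in> r \<Longrightarrow> b = c"
  unfolding partial_injection_def single_valued_def by blast

lemma partial_injection_left: "partial_injection r \<Longrightarrow> (a, c) \<in> r \<Longrightarrow> (b, c) \<in> r \<Longrightarrow> a = b"
  unfolding partial_injection_def single_valued_def by blast

lemma partial_injection_relcomp:
  "partial_injection r \<Longrightarrow> partial_injection s \<Longrightarrow> partial_injection (r O s)"
  by (intro partial_injectionI) (blast dest: partial_injection_left partial_injection_right)+

lemma partial_injection_converse: "partial_injection r \<Longrightarrow> partial_injection (r\<inverse>)"
  by (simp add: partial_injection_def)

text \<open>Each equation yields one inclusion. A pair (a, b) of q factors through q, p, q as a, c,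
  d, b, and injectivity of q forces c = b and d = a, so p contains (b, a).\<close>

lemma partial_injection_inverse_unique:
  assumes r: "partial_injection r" and t: "partial_injection t"
    and "r O t O r = r" and "t O r O t = t"
  shows "t = r\<inverse>"
proof -
  have *: "q\<inverse> \<subseteq> p" if q: "partial_injection q" and qpq: "q O p O q = q" for p q :: "'x rel"
  proof clarify
    fix a b assume ab: "(a, b) \<in> q"
    then obtain c d where "(a, c) \<in> q" "(c, d) \<in> p" "(d, b) \<in> q" using qpq by blast
    with ab q show "(b, a) \<in> p"
      by (metis partial_injection_left partial_injection_right)
  qed
  show ?thesis using *[OF r assms(3)] *[OF t assms(4)] by (auto simp: subset_iff)
qed

text \<open>For s = t this is the regularity law of an inverse. For general s it exhibits s as t
  times the idempotent s^-1 s, which turns inclusion into the natural order.\<close>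

lemma partial_injection_relcomp_converse_self:
  assumes "partial_injection t" "s \<subseteq> t"
  shows "t O s\<inverse> O s = s"
  using assms by (auto dest: partial_injection_left partial_injection_right)

lemma partial_injection_idem_iff:
  assumes r: "partial_injection r"
  shows "r O r = r \<longleftrightarrow> r \<subseteq> Id"
proof
  assume rr: "r O r = r"
  show "r \<subseteq> Id"
  proof clarify
    fix a b assume ab: "(a, b) \<in> r"
    then obtain c where "(a, c) \<in> r" "(c, b) \<in> r" using rr by blast
    with ab r show "a = b" by (metis partial_injection_left partial_injection_right)
  qed
qed blast

text \<open>The right-hand side is pairwise compatibility, read in relations; the instance a = b
  says that each single relation is a partial injection.\<close>

lemma partial_injection_Union_iff:
  "partial_injection (\<Union>(f ` A)) \<longleftrightarrow>
     (\<forall>a\<in>A. \<forall>b\<in>A. (f a)\<inverse> O f b \<subseteq> Id \<and> f a O (f b)\<inverse> \<subseteq> Id)"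
  (is "?l \<longleftrightarrow> ?r")
proof
  assume l: ?l
  show ?r
  proof (intro ballI conjI)
    fix a b assume ab: "a \<in> A" "b \<in> A"
    show "(f a)\<inverse> O f b \<subseteq> Id"
      using ab by (auto intro: partial_injection_right[OF l])
    show "f a O (f b)\<inverse> \<subseteq> Id"
      using ab by (auto intro: partial_injection_left[OF l])
  qed
next
  assume ?r
  then have r: "\<And>a b x y z. a \<in> A \<Longrightarrow> b \<in> A \<Longrightarrow> (x, y) \<in> f a \<Longrightarrow> (x, z) \<in> f b \<Longrightarrow> y = z"
    "\<And>a b x y z. a \<in> A \<Longrightarrow> b \<in> A \<Longrightarrow> (x, z) \<in> f a \<Longrightarrow> (y, z) \<in> f b \<Longrightarrow> x = y"
    by blast+
  show ?l
    by (rule partial_injectionI) (use r in \<open>force+\<close>)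
qed

text \<open>Associativity and uniqueness of inverses are left to be derived: for ideals and
  quotients they are not known in advance, whereas a multiplicative map to partial injections is
  easy to exhibit.\<close>

locale partial_injection_rep =
  fixes S :: "('a, 'm) zero_semigroup_scheme" and \<phi> :: "'a \<Rightarrow> 'x rel"
  assumes closed: "\<lbrakk>s \<in> carrier S; t \<in> carrier S\<rbrakk> \<Longrightarrow> s \<cdot>\<^bsub>S\<^esub> t \<in> carrier S"
    and zero: "\<o>\<^bsub>S\<^esub> \<in> carrier S"
    and rep_mult: "\<lbrakk>s \<in> carrier S; t \<in> carrier S\<rbrakk> \<Longrightarrow> \<phi> (s \<cdot>\<^bsub>S\<^esub> t) = \<phi> s O \<phi> t"
    and rep_zero: "\<phi> \<o>\<^bsub>S\<^esub> = {}"
    and rep_pinj: "s \<in> carrier S \<Longrightarrow> partial_injection (\<phi> s)"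
    and rep_inverse: "s \<in> carrier S \<Longrightarrow> \<exists>t \<in> carrier S. \<phi> t = (\<phi> s)\<inverse>"
begin

lemma rep_idempotent: "e \<in> idempotents S \<Longrightarrow> \<phi> e \<subseteq> Id"
  using rep_mult[of e e] rep_pinj[of e] partial_injection_idem_iff[of "\<phi> e"]
  by (simp add: idempotents_def)

lemma rep_mono: "nat_le S s t \<Longrightarrow> \<phi> s \<subseteq> \<phi> t"
proof -
  assume "nat_le S s t"
  then obtain e where "t \<in> carrier S" "e \<in> idempotents S" "s = t \<cdot>\<^bsub>S\<^esub> e"
    unfolding nat_le_def by blast
  then have "\<phi> s = \<phi> t O \<phi> e" by (simp add: rep_mult idempotents_def)
  also have "\<dots> \<subseteq> \<phi> t O Id"
    using rep_idempotent[OF \<open>e \<in> idempotents S\<close>] by (rule relcomp_mono[OF subset_refl])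
  finally show ?thesis by simp
qed

end

text \<open>Injectivity pulls the laws of partial injections back to \<open>S\<close>, so that
  inverses, idempotents, the natural order and compatibility can all be tested on relations.\<close>

locale faithful_rep = partial_injection_rep +
  assumes rep_inj: "inj_on \<phi> (carrier S)"
begin

lemma rep_eqD: "\<phi> s = \<phi> t \<Longrightarrow> s \<in> carrier S \<Longrightarrow> t \<in> carrier S \<Longrightarrow> s = t"
  using rep_inj by (rule inj_onD)

lemma is_inverse_iff:
  assumes "s \<in> carrier S" "t \<in> carrier S"
  shows "s \<cdot>\<^bsub>S\<^esub> t \<cdot>\<^bsub>S\<^esub> s = s \<and> t \<cdot>\<^bsub>S\<^esub> s \<cdot>\<^bsub>S\<^esub> t = t \<longleftrightarrow> \<phi> t = (\<phi> s)\<inverse>"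
proof
  assume "s \<cdot>\<^bsub>S\<^esub> t \<cdot>\<^bsub>S\<^esub> s = s \<and> t \<cdot>\<^bsub>S\<^esub> s \<cdot>\<^bsub>S\<^esub> t = t"
  then have "(\<phi> s O \<phi> t) O \<phi> s = \<phi> s" "(\<phi> t O \<phi> s) O \<phi> t = \<phi> t"
    using assms by (metis rep_mult closed)+
  then show "\<phi> t = (\<phi> s)\<inverse>"
    using partial_injection_inverse_unique rep_pinj assms by (metis O_assoc)
next
  assume t: "\<phi> t = (\<phi> s)\<inverse>"
  have "\<phi> s O \<phi> t O \<phi> s = \<phi> s"
    using t partial_injection_relcomp_converse_self[OF rep_pinj[OF assms(1)] subset_refl] by simp
  moreover have "\<phi> t O \<phi> s O \<phi> t = \<phi> t"
    using t partial_injection_relcomp_converse_self[OF rep_pinj[OF assms(2)] subset_refl] by simp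
  ultimately show "s \<cdot>\<^bsub>S\<^esub> t \<cdot>\<^bsub>S\<^esub> s = s \<and> t \<cdot>\<^bsub>S\<^esub> s \<cdot>\<^bsub>S\<^esub> t = t"
    using assms by (intro conjI; intro rep_eqD) (simp_all add: rep_mult closed O_assoc)
qed

lemma ex1_inverse:
  assumes s: "s \<in> carrier S"
  shows "\<exists>!t. t \<in> carrier S \<and> s \<cdot>\<^bsub>S\<^esub> t \<cdot>\<^bsub>S\<^esub> s = s \<and> t \<cdot>\<^bsub>S\<^esub> s \<cdot>\<^bsub>S\<^esub> t = t"
proof -
  obtain t where "t \<in> carrier S" "\<phi> t = (\<phi> s)\<inverse>" using rep_inverse[OF s] by blast
  then have "\<exists>!t. t \<in> carrier S \<and> \<phi> t = (\<phi> s)\<inverse>" by (metis rep_eqD)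
  then show ?thesis using is_inverse_iff[OF s] by (simp cong: conj_cong)
qed

lemma inverse_semigroup_zero: "inverse_semigroup_zero S"
proof
  fix s t u assume "s \<in> carrier S" "t \<in> carrier S" "u \<in> carrier S"
  then show "s \<cdot>\<^bsub>S\<^esub> t \<cdot>\<^bsub>S\<^esub> u = s \<cdot>\<^bsub>S\<^esub> (t \<cdot>\<^bsub>S\<^esub> u)"
    by (intro rep_eqD) (simp_all add: rep_mult closed O_assoc)
next
  fix s assume "s \<in> carrier S"
  then show "\<o>\<^bsub>S\<^esub> \<cdot>\<^bsub>S\<^esub> s = \<o>\<^bsub>S\<^esub>" "s \<cdot>\<^bsub>S\<^esub> \<o>\<^bsub>S\<^esub> = \<o>\<^bsub>S\<^esub>"
    by (auto intro!: rep_eqD simp: rep_mult closed rep_zero zero)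
qed (simp_all add: closed zero ex1_inverse)

lemma sg_inverse:
  assumes "s \<in> carrier S"
  shows sg_inverse_closed: "sg_inverse S s \<in> carrier S"
    and rep_sg_inverse: "\<phi> (sg_inverse S s) = (\<phi> s)\<inverse>"
  using theI'[OF ex1_inverse[OF assms]] is_inverse_iff[OF assms]
  unfolding sg_inverse_def by blast+

lemma idempotents_iff: "e \<in> idempotents S \<longleftrightarrow> e \<in> carrier S \<and> \<phi> e \<subseteq> Id"
proof -
  have "e \<cdot>\<^bsub>S\<^esub> e = e" if "e \<in> carrier S" "\<phi> e \<subseteq> Id"
    using that partial_injection_idem_iff[OF rep_pinj] by (intro rep_eqD) (simp_all add: rep_mult closed)
  then show ?thesis using rep_idempotent by (auto simp: idempotents_def)
qed

lemma nat_le_iff: "nat_le S s t \<longleftrightarrow> s \<in> carrier S \<and> t \<in> carrier S \<and> \<phi> s \<subseteq> \<phi> t"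
proof -
  have "\<exists>e \<in> idempotents S. s = t \<cdot>\<^bsub>S\<^esub> e"
    if "s \<in> carrier S" "t \<in> carrier S" "\<phi> s \<subseteq> \<phi> t"
  proof
    let ?e = "sg_inverse S s \<cdot>\<^bsub>S\<^esub> s"
    have e: "?e \<in> carrier S" "\<phi> ?e = (\<phi> s)\<inverse> O \<phi> s"
      using that by (simp_all add: closed sg_inverse_closed rep_mult rep_sg_inverse)
    moreover have "(\<phi> s)\<inverse> O \<phi> s \<subseteq> Id"
      using rep_pinj[OF that(1)] by (auto dest: partial_injection_right)
    ultimately show "?e \<in> idempotents S" by (simp add: idempotents_iff)
    show "s = t \<cdot>\<^bsub>S\<^esub> ?e"
      using that e partial_injection_relcomp_converse_self[OF rep_pinj that(3)]
      by (intro rep_eqD) (simp_all add: rep_mult closed)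
  qed
  then show ?thesis using rep_mono by (auto simp: nat_le_def)
qed

lemma compatible_iff:
  assumes "s \<in> carrier S" "t \<in> carrier S"
  shows "compatible S s t \<longleftrightarrow> (\<phi> s)\<inverse> O \<phi> t \<subseteq> Id \<and> \<phi> s O (\<phi> t)\<inverse> \<subseteq> Id"
  using assms
  by (simp add: compatible_def idempotents_iff rep_mult rep_sg_inverse closed sg_inverse_closed)

lemma fin_compatible_sets_iff:
  "A \<in> fin_compatible_sets S \<longleftrightarrow>
     A \<subseteq> carrier S \<and> finite A \<and> A \<noteq> {} \<and> partial_injection (\<Union>(\<phi> ` A))"
proof -
  have "(\<forall>a\<in>A. \<forall>b\<in>A. compatible S a b) \<longleftrightarrow> partial_injection (\<Union>(\<phi> ` A))"
    if "A \<subseteq> carrier S"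
    using that by (simp add: partial_injection_Union_iff compatible_iff subset_iff)
  then show ?thesis by (auto simp: fin_compatible_sets_def)
qed

end

section \<open>Transport of representations to quotients and to ideals\<close>

text \<open>All members of a class have the same relation, so the union over a class is that
  relation. This serves both quotients in the completion, first by \<leftrightarrow> and then by
  \<equiv>.\<close>

lemma (in partial_injection_rep) kernel_quotient:
  assumes R: "R = {(a, b). a \<in> carrier S \<and> b \<in> carrier S \<and> \<phi> a = \<phi> b}"
  defines "\<Phi> \<equiv> \<lambda>X. \<Union>(\<phi> ` X)"
  shows kernel_quotient_faithful: "faithful_rep (quotient_semigroup S R) \<Phi>"
    and kernel_quotient_image: "\<Phi> ` carrier (quotient_semigroup S R) = \<phi> ` carrier S"
proof -
  let ?Q = "quotient_semigroup S R"
  have carr: "carrier ?Q = (\<lambda>a. R `` {a}) ` carrier S"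
    by (auto simp: quotient_semigroup_def quotient_def)
  have \<Phi>: "\<Phi> (R `` {a}) = \<phi> a" if "a \<in> carrier S" for a
    using that by (auto simp: \<Phi>_def R)
  have cls: "R `` {a} = R `` {b} \<longleftrightarrow> \<phi> a = \<phi> b" if "a \<in> carrier S" "b \<in> carrier S" for a b
    using that by (auto simp: R)
  have mult: "R `` {a} \<cdot>\<^bsub>?Q\<^esub> R `` {b} = R `` {a \<cdot>\<^bsub>S\<^esub> b}"
    if ab: "a \<in> carrier S" "b \<in> carrier S" for a b
  proof -
    have "R `` {x \<cdot>\<^bsub>S\<^esub> y} = R `` {a \<cdot>\<^bsub>S\<^esub> b}" if "x \<in> R `` {a}" "y \<in> R `` {b}" for x y
      using ab that by (subst cls) (auto simp: R closed rep_mult)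
    then have "R `` {a} \<cdot>\<^bsub>?Q\<^esub> R `` {b} = (\<Union>x\<in>R `` {a}. \<Union>y\<in>R `` {b}. R `` {a \<cdot>\<^bsub>S\<^esub> b})"
      by (simp add: quotient_semigroup_def)
    \<comment> \<open>The product of classes is a union over representatives; it equals the constant
      value only because the classes are non-empty.\<close>
    moreover have "a \<in> R `` {a}" "b \<in> R `` {b}" using ab by (auto simp: R)
    ultimately show ?thesis by (metis UN_constant empty_iff)
  qed
  have zero': "\<o>\<^bsub>?Q\<^esub> = R `` {\<o>\<^bsub>S\<^esub>}" by (simp add: quotient_semigroup_def)
  show "faithful_rep ?Q \<Phi>"
  proof
    show "inj_on \<Phi> (carrier ?Q)" by (auto simp: carr inj_on_def \<Phi> cls)
    show "\<exists>t\<in>carrier ?Q. \<Phi> t = (\<Phi> s)\<inverse>" if "s \<in> carrier ?Q" for s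
      using that rep_inverse by (fastforce simp: carr \<Phi>)
  qed (auto simp: carr \<Phi> mult zero' closed zero rep_mult rep_zero rep_pinj)
  show "\<Phi> ` carrier ?Q = \<phi> ` carrier S"
    by (auto simp: carr image_image \<Phi> cong: image_cong)
qed

text \<open>Passing to the generated ideal adds only subrelations, so an ideal and its generators
  have the same union. Injectivity is not claimed: different ideals can have equal unions, and
  \<equiv> will identify them.\<close>

lemma (in faithful_rep) FC_rep:
  defines "\<Phi> \<equiv> \<lambda>X. \<Union>(\<phi> ` X)"
  shows rep_down_closure: "A \<subseteq> carrier S \<Longrightarrow> \<Phi> (down_closure S A) = \<Phi> A"
    and FC_partial_injection_rep: "partial_injection_rep (FC S) \<Phi>"
proof -
  show down: "\<Phi> (down_closure S A) = \<Phi> A" if "A \<subseteq> carrier S" for A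
    using that by (auto simp: \<Phi>_def down_closure_def nat_le_iff)
  have mult: "down_closure S A \<cdot>\<^bsub>FC S\<^esub> down_closure S B = down_closure S ((\<lambda>(a, b). a \<cdot>\<^bsub>S\<^esub> b) ` (A \<times> B))"
    if A: "A \<subseteq> carrier S" and B: "B \<subseteq> carrier S" for A B
  proof (intro equalityI subsetI)
    fix z assume "z \<in> down_closure S A \<cdot>\<^bsub>FC S\<^esub> down_closure S B"
    then obtain x y a b where *: "z = x \<cdot>\<^bsub>S\<^esub> y" "nat_le S x a" "nat_le S y b" "a \<in> A" "b \<in> B"
      unfolding FC_def down_closure_def by auto
    then have "nat_le S z (a \<cdot>\<^bsub>S\<^esub> b)" by (auto simp: nat_le_iff closed rep_mult)
    with * show "z \<in> down_closure S ((\<lambda>(a, b). a \<cdot>\<^bsub>S\<^esub> b) ` (A \<times> B))"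
      unfolding down_closure_def by auto
  next
    fix z assume "z \<in> down_closure S ((\<lambda>(a, b). a \<cdot>\<^bsub>S\<^esub> b) ` (A \<times> B))"
    then obtain a b where ab: "a \<in> A" "b \<in> B" "nat_le S z (a \<cdot>\<^bsub>S\<^esub> b)"
      unfolding down_closure_def by auto
    then obtain e where e: "e \<in> idempotents S" "z = (a \<cdot>\<^bsub>S\<^esub> b) \<cdot>\<^bsub>S\<^esub> e"
      unfolding nat_le_def by blast
    have carr: "a \<in> carrier S" "b \<in> carrier S" "e \<in> carrier S"
      using ab A B e by (auto simp: idempotents_def)
    \<comment> \<open>An element below a product ab is a times an element below b, so the setwise
      product of two ideals is the ideal generated by the products of generators.\<close>
    have "z = a \<cdot>\<^bsub>S\<^esub> (b \<cdot>\<^bsub>S\<^esub> e)"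
      using e carr inverse_semigroup_zero inverse_semigroup_zero.mult_assoc by metis
    moreover have "nat_le S (b \<cdot>\<^bsub>S\<^esub> e) b" using carr e closed unfolding nat_le_def by blast
    moreover have "nat_le S a a" using carr by (simp add: nat_le_iff)
    ultimately show "z \<in> down_closure S A \<cdot>\<^bsub>FC S\<^esub> down_closure S B"
      using ab unfolding FC_def down_closure_def by auto
  qed
  have carr: "carrier (FC S) = down_closure S ` fin_compatible_sets S" by (simp add: FC_def)
  have prod: "\<Phi> ((\<lambda>(a, b). a \<cdot>\<^bsub>S\<^esub> b) ` (A \<times> B)) = \<Phi> A O \<Phi> B"
    if A: "A \<subseteq> carrier S" and B: "B \<subseteq> carrier S" for A B
  proof -
    have "\<phi> (a \<cdot>\<^bsub>S\<^esub> b) = \<phi> a O \<phi> b" if "a \<in> A" "b \<in> B" for a b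
      using that A B rep_mult by blast
    then show ?thesis unfolding \<Phi>_def by fastforce
  qed
  have compI: "(\<lambda>(a, b). a \<cdot>\<^bsub>S\<^esub> b) ` (A \<times> B) \<in> fin_compatible_sets S"
    if "A \<in> fin_compatible_sets S" "B \<in> fin_compatible_sets S" for A B
    using that prod[of A B] unfolding fin_compatible_sets_iff \<Phi>_def
    by (auto intro: partial_injection_relcomp closed)
  have sub: "A \<subseteq> carrier S" if "A \<in> fin_compatible_sets S" for A
    using that by (simp add: fin_compatible_sets_iff)
  show "partial_injection_rep (FC S) \<Phi>"
  proof
    fix X Y assume "X \<in> carrier (FC S)" "Y \<in> carrier (FC S)"
    then obtain A B where *: "X = down_closure S A" "A \<in> fin_compatible_sets S"
      "Y = down_closure S B" "B \<in> fin_compatible_sets S" by (auto simp: carr)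
    show "X \<cdot>\<^bsub>FC S\<^esub> Y \<in> carrier (FC S)"
      using * compI by (simp add: mult sub carr)
    show "\<Phi> (X \<cdot>\<^bsub>FC S\<^esub> Y) = \<Phi> X O \<Phi> Y"
      using * sub[OF compI] by (simp add: mult sub down prod)
  next
    show "\<o>\<^bsub>FC S\<^esub> \<in> carrier (FC S)" unfolding FC_def
      by (simp add: fin_compatible_sets_iff zero rep_zero partial_injection_def)
    show "\<Phi> \<o>\<^bsub>FC S\<^esub> = {}" using down[of "{\<o>\<^bsub>S\<^esub>}"] by (simp add: FC_def zero \<Phi>_def rep_zero)
  next
    fix X assume "X \<in> carrier (FC S)"
    then obtain A where *: "X = down_closure S A" "A \<in> fin_compatible_sets S" by (auto simp: carr)
    then show "partial_injection (\<Phi> X)"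
      using down[of A] by (simp add: fin_compatible_sets_iff) (simp add: \<Phi>_def)
    let ?B = "sg_inverse S ` A"
    have "\<Phi> ?B = (\<Phi> A)\<inverse>" using sub[OF *(2)] rep_sg_inverse unfolding \<Phi>_def by fastforce
    moreover from this have "?B \<in> fin_compatible_sets S"
      using * sg_inverse_closed
      by (auto simp: fin_compatible_sets_iff \<Phi>_def intro: partial_injection_converse)
    ultimately show "\<exists>t\<in>carrier (FC S). \<Phi> t = (\<Phi> X)\<inverse>"
      using * sub by (intro bexI[of _ "down_closure S ?B"]) (simp_all add: carr down)
  qed
qed

lemma Upper_pair:
  "\<lbrakk>x \<in> carrier L; y \<in> carrier L\<rbrakk> \<Longrightarrow>
     Upper L {x, y} = {u \<in> carrier L. x \<sqsubseteq>\<^bsub>L\<^esub> u \<and> y \<sqsubseteq>\<^bsub>L\<^esub> u}"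
  unfolding Upper_def by blast

lemma Lower_pair:
  "\<lbrakk>x \<in> carrier L; y \<in> carrier L\<rbrakk> \<Longrightarrow>
     Lower L {x, y} = {l \<in> carrier L. l \<sqsubseteq>\<^bsub>L\<^esub> x \<and> l \<sqsubseteq>\<^bsub>L\<^esub> y}"
  unfolding Lower_def by blast

section \<open>Generalized Boolean algebras from rings of sets\<close>

lemma generalized_boolean_algebra_of_ring:
  fixes L :: "'a gorder" and f :: "'a \<Rightarrow> 'b set"
  assumes eq: "eq L = (=)"
    and le: "\<And>x y. x \<in> carrier L \<Longrightarrow> y \<in> carrier L \<Longrightarrow> x \<sqsubseteq>\<^bsub>L\<^esub> y \<longleftrightarrow> f x \<subseteq> f y"
    and inj: "inj_on f (carrier L)"
    and empty: "{} \<in> f ` carrier L"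
    and union: "\<And>X Y. X \<in> f ` carrier L \<Longrightarrow> Y \<in> f ` carrier L \<Longrightarrow> X \<union> Y \<in> f ` carrier L"
    and diff: "\<And>X Y. X \<in> f ` carrier L \<Longrightarrow> Y \<in> f ` carrier L \<Longrightarrow> X - Y \<in> f ` carrier L"
  shows "generalized_boolean_algebra L"
proof -
  have eqD: "x = y" if "x \<in> carrier L" "y \<in> carrier L" "f x = f y" for x y
    using inj that by (simp add: inj_on_def)
  have inter: "X \<inter> Y \<in> f ` carrier L" if "X \<in> f ` carrier L" "Y \<in> f ` carrier L" for X Y
    using diff[OF that(1) diff[OF that]] by (simp add: Diff_Diff_Int)
  have lub: "least L s (Upper L {x, y})"
    if "x \<in> carrier L" "y \<in> carrier L" "s \<in> carrier L" "f s = f x \<union> f y" for s x y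
    unfolding least_def Upper_pair[OF that(1,2)]
    using that(1-3) by (simp add: le that(4) cong: conj_cong)
  have glb: "greatest L s (Lower L {x, y})"
    if "x \<in> carrier L" "y \<in> carrier L" "s \<in> carrier L" "f s = f x \<inter> f y" for s x y
    unfolding greatest_def Lower_pair[OF that(1,2)]
    using that(1-3) by (simp add: le that(4) cong: conj_cong)
  interpret partial_order L
    by unfold_locales (auto simp: eq le intro: eqD)
  interpret Lattice.lattice L
  proof
    fix x y assume xy: "x \<in> carrier L" "y \<in> carrier L"
    then show "\<exists>s. least L s (Upper L {x, y})" using union[of "f x" "f y"] lub[OF xy] by fastforce
    show "\<exists>s. greatest L s (Lower L {x, y})" using xy inter[of "f x" "f y"] glb[OF xy] by fastforce
  qed
  have join: "f (x \<squnion>\<^bsub>L\<^esub> y) = f x \<union> f y" if xy: "x \<in> carrier L" "y \<in> carrier L" for x y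
  proof -
    obtain s where s: "s \<in> carrier L" "f s = f x \<union> f y" using xy union[of "f x" "f y"] by fastforce
    then have "x \<squnion>\<^bsub>L\<^esub> y = s"
      unfolding join_def sup_def using lub[OF xy s] by (metis least_unique someI)
    with s show ?thesis by simp
  qed
  have meet: "f (x \<sqinter>\<^bsub>L\<^esub> y) = f x \<inter> f y" if xy: "x \<in> carrier L" "y \<in> carrier L" for x y
  proof -
    obtain s where s: "s \<in> carrier L" "f s = f x \<inter> f y" using xy inter[of "f x" "f y"] by fastforce
    then have "x \<sqinter>\<^bsub>L\<^esub> y = s"
      unfolding meet_def inf_def using glb[OF xy s] by (metis greatest_unique someI)
    with s show ?thesis by simp
  qed
  show ?thesis
  proof
    obtain b where "b \<in> carrier L" "f b = {}" using empty by fastforce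
    then show "\<exists>b. least L b (carrier L)" by (auto simp: least_def le)
  next
    fix x y z assume "x \<in> carrier L" "y \<in> carrier L" "z \<in> carrier L"
    then show "x \<sqinter>\<^bsub>L\<^esub> (y \<squnion>\<^bsub>L\<^esub> z) = (x \<sqinter>\<^bsub>L\<^esub> y) \<squnion>\<^bsub>L\<^esub> (x \<sqinter>\<^bsub>L\<^esub> z)"
      by (intro eqD) (auto simp: meet join)
  next
    fix x y z assume xyz: "x \<in> carrier L" "y \<in> carrier L" "z \<in> carrier L" "x \<sqsubseteq>\<^bsub>L\<^esub> y" "y \<sqsubseteq>\<^bsub>L\<^esub> z"
    \<comment> \<open>The complement of y in the interval from x to z consists of x and the part of
      z outside y.\<close>
    then have "f x \<union> (f z - f y) \<in> f ` carrier L" by (intro union diff) auto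
    then obtain c where c: "c \<in> carrier L" "f c = f x \<union> (f z - f y)" by fastforce
    have "f x \<subseteq> f y" "f y \<subseteq> f z" using xyz by (simp_all add: le)
    then have "f y \<inter> f c = f x" "f y \<union> f c = f z" unfolding c(2) by blast+
    with xyz c have "y \<sqinter>\<^bsub>L\<^esub> c = x" "y \<squnion>\<^bsub>L\<^esub> c = z"
      by (intro eqD; simp add: meet join)+
    with c show "\<exists>c\<in>carrier L. y \<sqinter>\<^bsub>L\<^esub> c = x \<and> y \<squnion>\<^bsub>L\<^esub> c = z" by blast
  qed
qed

section \<open>Tight representations\<close>

text \<open>
  The faithful representation \<open>\<psi>\<close> only serves to make \<open>S\<close> an inverse semigroup, whereas \<open>\<phi>\<close>
  identifies exactly the elements related by \<open>\<leftrightarrow>\<close>.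
\<close>

locale tight_rep = faithful_rep S \<psi> + tight: partial_injection_rep S \<phi>
  for S :: "('a, 'm) zero_semigroup_scheme" and \<psi> :: "'a \<Rightarrow> 'y rel" and \<phi> :: "'a \<Rightarrow> 'x rel" +
  assumes empty_imp_zero: "s \<in> carrier S \<Longrightarrow> \<phi> s = {} \<Longrightarrow> s = \<o>\<^bsub>S\<^esub>"
    and comparable:
      "\<lbrakk>s \<in> carrier S; t \<in> carrier S; \<phi> s \<inter> \<phi> t \<noteq> {}\<rbrakk> \<Longrightarrow> nat_le S s t \<or> nat_le S t s"
    and decide:
      "\<lbrakk>a \<in> carrier S; b \<in> carrier S; p \<in> \<phi> a\<rbrakk> \<Longrightarrow>
         \<exists>s. nat_le S s a \<and> p \<in> \<phi> s \<and> (\<phi> s \<subseteq> \<phi> b \<or> \<phi> s \<inter> \<phi> b = {})"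
begin

text \<open>Overlapping elements are comparable, so their meet is the smaller one. For elements
  without overlap, a common lower bound has empty relation and hence is zero.\<close>

lemma meet_facts:
  assumes s: "s \<in> carrier S" and t: "t \<in> carrier S"
  shows meet_exists: "\<exists>m. greatest (natural_order S) m (Lower (natural_order S) {s, t})"
    and meet_nonzero_iff: "s \<sqinter>\<^bsub>natural_order S\<^esub> t \<noteq> \<o>\<^bsub>S\<^esub> \<longleftrightarrow> \<phi> s \<inter> \<phi> t \<noteq> {}"
proof -
  have glb: "greatest (natural_order S) m (Lower (natural_order S) {s, t}) \<longleftrightarrow>
      nat_le S m s \<and> nat_le S m t \<and> (\<forall>l. nat_le S l s \<and> nat_le S l t \<longrightarrow> nat_le S l m)" for m
  proof -
    have "Lower (natural_order S) {s, t} = {l. nat_le S l s \<and> nat_le S l t}"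
      using s t by (subst Lower_pair) (auto simp: natural_order_def nat_le_iff)
    then show ?thesis by (auto simp: greatest_def natural_order_def nat_le_iff)
  qed
  show ex: "\<exists>m. greatest (natural_order S) m (Lower (natural_order S) {s, t})"
  proof (cases "\<phi> s \<inter> \<phi> t = {}")
    case True
    have "l = \<o>\<^bsub>S\<^esub>" if "nat_le S l s" "nat_le S l t" for l
      using tight.rep_mono[OF that(1)] tight.rep_mono[OF that(2)] True that
      by (intro empty_imp_zero) (auto simp: nat_le_iff)
    then have "greatest (natural_order S) \<o>\<^bsub>S\<^esub> (Lower (natural_order S) {s, t})"
      unfolding glb using s t zero rep_zero by (auto simp: nat_le_iff)
    then show ?thesis by blast
  next
    case False
    then have "nat_le S s t \<or> nat_le S t s" by (intro comparable s t)
    then show ?thesis unfolding glb using s t nat_le_iff by blast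
  qed
  have is_glb: "greatest (natural_order S) (s \<sqinter>\<^bsub>natural_order S\<^esub> t) (Lower (natural_order S) {s, t})"
    unfolding meet_def inf_def using ex by (rule someI_ex)
  let ?m = "s \<sqinter>\<^bsub>natural_order S\<^esub> t"
  have m: "nat_le S ?m s" "nat_le S ?m t" "\<And>l. nat_le S l s \<Longrightarrow> nat_le S l t \<Longrightarrow> nat_le S l ?m"
    using is_glb unfolding glb by blast+
  show "?m \<noteq> \<o>\<^bsub>S\<^esub> \<longleftrightarrow> \<phi> s \<inter> \<phi> t \<noteq> {}"
  proof
    assume "?m \<noteq> \<o>\<^bsub>S\<^esub>"
    moreover have "?m \<in> carrier S" using m by (simp add: nat_le_iff)
    ultimately show "\<phi> s \<inter> \<phi> t \<noteq> {}"
      using empty_imp_zero tight.rep_mono[OF m(1)] tight.rep_mono[OF m(2)] by blast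
  next
    assume ne: "\<phi> s \<inter> \<phi> t \<noteq> {}"
    then consider "nat_le S s t" | "nat_le S t s" using comparable s t by blast
    then have "\<phi> s \<subseteq> \<phi> ?m \<or> \<phi> t \<subseteq> \<phi> ?m"
      using m(3)[of s] m(3)[of t] s t tight.rep_mono nat_le_iff by blast
    then show "?m \<noteq> \<o>\<^bsub>S\<^esub>" using ne tight.rep_zero by auto
  qed
qed

lemma inverse_meet_semigroup: "inverse_meet_semigroup S"
  using inverse_semigroup_zero meet_exists
  by (simp add: inverse_meet_semigroup_def inverse_meet_semigroup_axioms_def)

text \<open>Shrink the neighbourhood of p once for each member of B; earlier decisions survive the
  passage to a subset.\<close>

lemma decide_finite:
  assumes "finite B" "B \<subseteq> carrier S" "a \<in> carrier S" "p \<in> \<phi> a"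
  shows "\<exists>s. nat_le S s a \<and> p \<in> \<phi> s \<and> (\<forall>b \<in> B. \<phi> s \<subseteq> \<phi> b \<or> \<phi> s \<inter> \<phi> b = {})"
  using assms
proof (induction B rule: finite_induct)
  case empty
  then show ?case by (auto simp: nat_le_iff)
next
  case (insert b B)
  then obtain s where s: "nat_le S s a" "p \<in> \<phi> s" "\<forall>b \<in> B. \<phi> s \<subseteq> \<phi> b \<or> \<phi> s \<inter> \<phi> b = {}" by auto
  then obtain t where t: "nat_le S t s" "p \<in> \<phi> t" "\<phi> t \<subseteq> \<phi> b \<or> \<phi> t \<inter> \<phi> b = {}"
    using decide[of s b p] insert.prems by (auto simp: nat_le_iff)
  have "nat_le S t a" using s t by (auto simp: nat_le_iff)
  moreover have "\<phi> t \<subseteq> \<phi> s" using t tight.rep_mono by blast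
  ultimately show ?case using s t by blast
qed

text \<open>Around a point p of a, take s below a that is decided against every b in B. Since s is
  non-zero, the arrow gives some b meeting s; being decided, s lies inside this b, and so does p.
  Conversely, every non-zero x has a point, and a b containing that point meets x.\<close>

lemma arrow_iff:
  assumes A: "A \<subseteq> carrier S" and B: "B \<subseteq> carrier S" "finite B"
  shows "arrow S A B \<longleftrightarrow> \<Union>(\<phi> ` A) \<subseteq> \<Union>(\<phi> ` B)"
proof
  assume arr: "arrow S A B"
  show "\<Union>(\<phi> ` A) \<subseteq> \<Union>(\<phi> ` B)"
  proof
    fix p assume "p \<in> \<Union>(\<phi> ` A)"
    then obtain a where a: "a \<in> A" "p \<in> \<phi> a" by blast
    then obtain s where s: "nat_le S s a" "p \<in> \<phi> s" "\<forall>b \<in> B. \<phi> s \<subseteq> \<phi> b \<or> \<phi> s \<inter> \<phi> b = {}"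
      using decide_finite[of B a p] A B by blast
    then have "s \<noteq> \<o>\<^bsub>S\<^esub>" using tight.rep_zero by auto
    then obtain b where b: "b \<in> B" "s \<sqinter>\<^bsub>natural_order S\<^esub> b \<noteq> \<o>\<^bsub>S\<^esub>"
      using arr a s unfolding arrow_def by blast
    then have "\<phi> s \<inter> \<phi> b \<noteq> {}" using meet_nonzero_iff[of s b] s B by (auto simp: nat_le_iff)
    then show "p \<in> \<Union>(\<phi> ` B)" using s b by blast
  qed
next
  assume sub: "\<Union>(\<phi> ` A) \<subseteq> \<Union>(\<phi> ` B)"
  show "arrow S A B"
    unfolding arrow_def
  proof (intro ballI allI impI)
    fix a x assume a: "a \<in> A" and x: "nat_le S x a \<and> x \<noteq> \<o>\<^bsub>S\<^esub>"
    then have xc: "x \<in> carrier S" by (simp add: nat_le_iff)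
    with x obtain p where p: "p \<in> \<phi> x" using empty_imp_zero by blast
    then have "p \<in> \<phi> a" using x tight.rep_mono by blast
    then obtain b where b: "b \<in> B" "p \<in> \<phi> b" using sub a by blast
    then have "x \<sqinter>\<^bsub>natural_order S\<^esub> b \<noteq> \<o>\<^bsub>S\<^esub>" using meet_nonzero_iff[of x b] xc B p by blast
    then show "\<exists>b\<in>B. x \<sqinter>\<^bsub>natural_order S\<^esub> b \<noteq> \<o>\<^bsub>S\<^esub>" using b by blast
  qed
qed

lemma biarrow_iff:
  assumes "A \<subseteq> carrier S" "finite A" "B \<subseteq> carrier S" "finite B"
  shows "biarrow S A B \<longleftrightarrow> \<Union>(\<phi> ` A) = \<Union>(\<phi> ` B)"
  using assms by (auto simp: biarrow_def arrow_iff)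

lemma biarrow_rel_kernel:
  "biarrow_rel S = {(a, b). a \<in> carrier S \<and> b \<in> carrier S \<and> \<phi> a = \<phi> b}"
  by (auto simp: biarrow_rel_def biarrow_iff)

lemma biarrow_quotient_image:
  "(\<lambda>X. \<Union>(\<phi> ` X)) ` carrier (biarrow_quotient S) = \<phi> ` carrier S"
  unfolding biarrow_quotient_def by (rule tight.kernel_quotient_image[OF biarrow_rel_kernel])

text \<open>The second congruence uses the order and the meets of the quotient, not those of
  \<open>S\<close>. In the quotient one map is both faithful and tight, so \<open>arrow_iff\<close>
  applies there as well.\<close>

lemma biarrow_quotient_tight:
  defines "\<Phi> \<equiv> \<lambda>X. \<Union>(\<phi> ` X)"
  shows "tight_rep (biarrow_quotient S) \<Phi> \<Phi>"
proof -
  interpret Q: faithful_rep "biarrow_quotient S" \<Phi>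
    unfolding biarrow_quotient_def \<Phi>_def
    by (rule tight.kernel_quotient_faithful[OF biarrow_rel_kernel])
  have image: "\<Phi> ` carrier (biarrow_quotient S) = \<phi> ` carrier S"
    unfolding \<Phi>_def by (rule biarrow_quotient_image)
  have lift: "\<exists>s \<in> carrier S. \<Phi> X = \<phi> s" if "X \<in> carrier (biarrow_quotient S)" for X
    using image that by (metis imageE imageI)
  show ?thesis
  proof
    fix X assume "X \<in> carrier (biarrow_quotient S)" "\<Phi> X = {}"
    then show "X = \<o>\<^bsub>biarrow_quotient S\<^esub>" by (intro Q.rep_eqD) (simp_all add: Q.rep_zero Q.zero)
  next
    fix X Y assume XY: "X \<in> carrier (biarrow_quotient S)" "Y \<in> carrier (biarrow_quotient S)"
      and ne: "\<Phi> X \<inter> \<Phi> Y \<noteq> {}"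
    obtain s t where "s \<in> carrier S" "t \<in> carrier S" "\<Phi> X = \<phi> s" "\<Phi> Y = \<phi> t"
      using lift[OF XY(1)] lift[OF XY(2)] by metis
    moreover from this have "nat_le S s t \<or> nat_le S t s" using ne by (intro comparable) simp_all
    ultimately have "\<Phi> X \<subseteq> \<Phi> Y \<or> \<Phi> Y \<subseteq> \<Phi> X" using tight.rep_mono by metis
    with XY show "nat_le (biarrow_quotient S) X Y \<or> nat_le (biarrow_quotient S) Y X"
      by (simp add: Q.nat_le_iff)
  next
    fix X Y p assume XY: "X \<in> carrier (biarrow_quotient S)" "Y \<in> carrier (biarrow_quotient S)"
      and p: "p \<in> \<Phi> X"
    obtain a b where ab: "a \<in> carrier S" "b \<in> carrier S" "\<Phi> X = \<phi> a" "\<Phi> Y = \<phi> b"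
      using lift[OF XY(1)] lift[OF XY(2)] by metis
    then obtain s where s: "nat_le S s a" "p \<in> \<phi> s" "\<phi> s \<subseteq> \<phi> b \<or> \<phi> s \<inter> \<phi> b = {}"
      using decide[of a b p] p by blast
    then obtain Z where Z: "Z \<in> carrier (biarrow_quotient S)" "\<Phi> Z = \<phi> s"
      using image nat_le_iff by (metis imageE imageI)
    have "nat_le (biarrow_quotient S) Z X"
      using Z XY ab tight.rep_mono[OF s(1)] Q.nat_le_iff by simp
    then show "\<exists>Z. nat_le (biarrow_quotient S) Z X \<and> p \<in> \<Phi> Z \<and> (\<Phi> Z \<subseteq> \<Phi> Y \<or> \<Phi> Z \<inter> \<Phi> Y = {})"
      using s ab Z by (intro exI[of _ Z]) simp
  qed
qed

text \<open>\<open>FC_rel\<close> speaks of some choice of generators. The union over an ideal does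
  not depend on that choice, and this makes \<equiv> a kernel.\<close>

lemma FC_rel_kernel:
  "FC_rel S = {(X, Y). X \<in> carrier (FC S) \<and> Y \<in> carrier (FC S) \<and> \<Union>(\<phi> ` X) = \<Union>(\<phi> ` Y)}"
proof -
  have down: "\<Union>(\<phi> ` down_closure S A) = \<Union>(\<phi> ` A)" if "A \<in> fin_compatible_sets S" for A
  proof
    show "\<Union>(\<phi> ` down_closure S A) \<subseteq> \<Union>(\<phi> ` A)"
      using tight.rep_mono unfolding down_closure_def by blast
    have "A \<subseteq> down_closure S A"
      using that by (auto simp: down_closure_def fin_compatible_sets_iff nat_le_iff)
    then show "\<Union>(\<phi> ` A) \<subseteq> \<Union>(\<phi> ` down_closure S A)" by blast
  qed
  have biarrow: "biarrow S A B \<longleftrightarrow> \<Union>(\<phi> ` down_closure S A) = \<Union>(\<phi> ` down_closure S B)"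
    if "A \<in> fin_compatible_sets S" "B \<in> fin_compatible_sets S" for A B
    using that biarrow_iff[of A B] down by (simp add: fin_compatible_sets_iff)
  have "FC_rel S = {(down_closure S A, down_closure S B) | A B.
      A \<in> fin_compatible_sets S \<and> B \<in> fin_compatible_sets S \<and>
      \<Union>(\<phi> ` down_closure S A) = \<Union>(\<phi> ` down_closure S B)}"
    unfolding FC_rel_def by (simp only: biarrow cong: conj_cong)
  then show ?thesis by (simp only: FC_def partial_object.simps) blast
qed

end

section \<open>A criterion for the completion to be Boolean\<close>

text \<open>Remove the members of B one at a time: each removal replaces every remaining piece by
  finitely many smaller ones. Hence only differences of two single members need checking.\<close>

lemma finite_unions_diff:
  assumes diff: "\<And>e f. e \<in> E \<Longrightarrow> f \<in> E \<Longrightarrow> \<exists>F \<subseteq> E. finite F \<and> g e - g f = \<Union>(g ` F)"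
    and "finite A" "A \<subseteq> E" "finite B" "B \<subseteq> E"
  shows "\<exists>C \<subseteq> E. finite C \<and> \<Union>(g ` A) - \<Union>(g ` B) = \<Union>(g ` C)"
  using assms(4,5)
proof (induction B rule: finite_induct)
  case empty
  then show ?case using assms(2,3) by auto
next
  case (insert f B)
  then obtain C where C: "C \<subseteq> E" "finite C" "\<Union>(g ` A) - \<Union>(g ` B) = \<Union>(g ` C)" by auto
  have "f \<in> E" using insert.prems by simp
  then have "\<forall>e \<in> C. \<exists>F. F \<subseteq> E \<and> finite F \<and> g e - g f = \<Union>(g ` F)"
    using diff[OF subsetD[OF C(1)]] by simp
  then obtain F where F: "\<And>e. e \<in> C \<Longrightarrow> F e \<subseteq> E \<and> finite (F e) \<and> g e - g f = \<Union>(g ` F e)"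
    by metis
  have "\<Union>(g ` A) - \<Union>(g ` insert f B) = (\<Union>e\<in>C. g e - g f)" using C by auto
  also have "\<dots> = \<Union>(g ` (\<Union>e\<in>C. F e))" using F by auto
  finally have "\<Union>(g ` A) - \<Union>(g ` insert f B) = \<Union>(g ` (\<Union>e\<in>C. F e))" .
  moreover have "(\<Union>e\<in>C. F e) \<subseteq> E" using F by (intro UN_least) simp
  moreover have "finite (\<Union>e\<in>C. F e)" using C F by simp
  ultimately show ?case by blast
qed

text \<open>\<open>E\<close> consists of the elements whose \<leftrightarrow>-class is idempotent.
  The idempotents of the completion correspond to the finite unions of their relations, and such
  unions form a ring of sets under the assumption.\<close>

theorem (in tight_rep) pre_booleanI:
  defines "E \<equiv> {e \<in> carrier S. \<phi> e \<subseteq> Id}"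
  assumes diff: "\<And>e f. e \<in> E \<Longrightarrow> f \<in> E \<Longrightarrow> \<exists>F \<subseteq> E. finite F \<and> \<phi> e - \<phi> f = \<Union>(\<phi> ` F)"
  shows "pre_boolean S"
proof -
  define \<Phi> where "\<Phi> = (\<lambda>X. \<Union>(\<phi> ` X))"
  define \<Theta> where "\<Theta> = (\<lambda>X. \<Union>(\<Phi> ` X))"
  define \<Xi> where "\<Xi> = (\<lambda>X. \<Union>(\<Theta> ` X))"
  let ?Q = "biarrow_quotient S" and ?D = "distributive_completion S"
  interpret Q: tight_rep ?Q \<Phi> \<Phi>
    unfolding \<Phi>_def by (rule biarrow_quotient_tight)
  interpret FC: partial_injection_rep "FC ?Q" \<Theta>
    unfolding \<Theta>_def by (rule Q.FC_partial_injection_rep)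
  have ker: "FC_rel ?Q = {(X, Y). X \<in> carrier (FC ?Q) \<and> Y \<in> carrier (FC ?Q) \<and> \<Theta> X = \<Theta> Y}"
    unfolding \<Theta>_def by (rule Q.FC_rel_kernel)
  interpret D: faithful_rep ?D \<Xi>
    unfolding \<Xi>_def distributive_completion_def by (rule FC.kernel_quotient_faithful[OF ker])
  have "\<Xi> ` carrier ?D = \<Theta> ` carrier (FC ?Q)"
    unfolding \<Xi>_def distributive_completion_def by (rule FC.kernel_quotient_image[OF ker])
  also have "\<dots> = \<Theta> ` fin_compatible_sets ?Q"
  proof -
    have "\<Theta> (down_closure ?Q A) = \<Theta> A" if "A \<in> fin_compatible_sets ?Q" for A
      unfolding \<Theta>_def using that by (intro Q.rep_down_closure) (simp add: Q.fin_compatible_sets_iff)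
    then show ?thesis by (simp add: FC_def image_image cong: image_cong)
  qed
  finally have image_D: "\<Xi> ` carrier ?D = \<Theta> ` fin_compatible_sets ?Q" .
  have image_Q: "\<Phi> ` carrier ?Q = \<phi> ` carrier S"
    unfolding \<Phi>_def by (rule biarrow_quotient_image)
  let ?L = "idempotent_order ?D"
  have image_L: "\<Xi> ` carrier ?L = {\<Union>(\<phi> ` A) | A. A \<subseteq> E \<and> finite A}"
  proof (intro equalityI subsetI)
    fix r assume "r \<in> \<Xi> ` carrier ?L"
    then have "r \<subseteq> Id" "r \<in> \<Xi> ` carrier ?D"
      by (auto simp: idempotent_order_def D.idempotents_iff)
    then obtain A where "A \<in> fin_compatible_sets ?Q" and r: "r = \<Union>(\<Phi> ` A)"
      unfolding image_D \<Theta>_def by (elim imageE)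
    then have A: "A \<subseteq> carrier ?Q" "finite A" by (simp_all add: Q.fin_compatible_sets_iff)
    have "\<forall>X \<in> A. \<exists>a. a \<in> carrier S \<and> \<Phi> X = \<phi> a"
      using A image_Q by (metis imageE imageI subsetD)
    then obtain g where g: "\<And>X. X \<in> A \<Longrightarrow> g X \<in> carrier S \<and> \<Phi> X = \<phi> (g X)" by metis
    have "r = \<Union>(\<phi> ` g ` A)" using g by (simp add: r image_image)
    moreover have "g ` A \<subseteq> E"
    proof
      fix a assume "a \<in> g ` A"
      then obtain X where X: "X \<in> A" "a = g X" by (elim imageE)
      then have "\<phi> a \<subseteq> r" using g by (auto simp: r)
      with X g \<open>r \<subseteq> Id\<close> show "a \<in> E" by (simp add: E_def)
    qed
    ultimately show "r \<in> {\<Union>(\<phi> ` A) | A. A \<subseteq> E \<and> finite A}" using A by blast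
  next
    fix r assume "r \<in> {\<Union>(\<phi> ` A) | A. A \<subseteq> E \<and> finite A}"
    then obtain A where A: "A \<subseteq> E" "finite A" "r = \<Union>(\<phi> ` A)" by blast
    have "\<forall>a \<in> A. \<exists>X \<in> carrier ?Q. \<Phi> X = \<phi> a"
      using A image_Q unfolding E_def by (metis (no_types, lifting) imageE imageI mem_Collect_eq subsetD)
    then obtain h where h: "\<And>a. a \<in> A \<Longrightarrow> h a \<in> carrier ?Q \<and> \<Phi> (h a) = \<phi> a" by metis
    \<comment> \<open>Members of \<open>fin_compatible_sets\<close> are non-empty; adding zero
      covers the empty union without changing the others.\<close>
    let ?B = "insert \<o>\<^bsub>?Q\<^esub> (h ` A)"
    have rB: "r = \<Union>(\<Phi> ` ?B)" using A h Q.rep_zero by (simp add: image_image)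
    have rId: "r \<subseteq> Id" unfolding A(3) using A(1) by (intro UN_least) (auto simp: E_def)
    then have "partial_injection r" by (intro partial_injectionI) blast+
    moreover have "?B \<subseteq> carrier ?Q" using h Q.zero by (simp add: image_subset_iff)
    ultimately have "?B \<in> fin_compatible_sets ?Q"
      using A(2) rB by (simp add: Q.fin_compatible_sets_iff)
    then have "r \<in> \<Xi> ` carrier ?D" unfolding image_D \<Theta>_def rB by (rule imageI)
    then show "r \<in> \<Xi> ` carrier ?L"
      using rId by (auto simp: idempotent_order_def D.idempotents_iff)
  qed
  have "generalized_boolean_algebra ?L"
  proof (rule generalized_boolean_algebra_of_ring[where f = \<Xi>])
    show "eq ?L = (=)" by (simp add: idempotent_order_def)
    show "le ?L x y \<longleftrightarrow> \<Xi> x \<subseteq> \<Xi> y" if "x \<in> carrier ?L" "y \<in> carrier ?L" for x y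
      using that by (simp add: idempotent_order_def D.nat_le_iff idempotents_def)
    show "inj_on \<Xi> (carrier ?L)"
      using D.rep_inj by (rule inj_on_subset) (auto simp: idempotent_order_def idempotents_def)
    show "{} \<in> \<Xi> ` carrier ?L" unfolding image_L by blast
    fix X Y assume "X \<in> \<Xi> ` carrier ?L" "Y \<in> \<Xi> ` carrier ?L"
    then obtain A B where AB: "X = \<Union>(\<phi> ` A)" "A \<subseteq> E" "finite A" "Y = \<Union>(\<phi> ` B)" "B \<subseteq> E" "finite B"
      unfolding image_L by blast
    have "X \<union> Y = \<Union>(\<phi> ` (A \<union> B))" "A \<union> B \<subseteq> E" "finite (A \<union> B)" using AB by auto
    then show "X \<union> Y \<in> \<Xi> ` carrier ?L" unfolding image_L by blast
    show "X - Y \<in> \<Xi> ` carrier ?L"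
      unfolding image_L using finite_unions_diff[OF diff, of A B] AB by blast
  qed
  then have "boolean_inverse_semigroup ?D"
    using D.inverse_semigroup_zero
    by (simp add: boolean_inverse_semigroup_def boolean_inverse_semigroup_axioms_def)
  then show ?thesis by (simp add: pre_boolean_def inverse_meet_semigroup)
qed

section \<open>The action of paths on backward sequences of arcs\<close>

type_synonym ('v, 'e) ray = "'v \<times> (nat \<Rightarrow> 'e option)"

abbreviation push :: "'e \<Rightarrow> (nat \<Rightarrow> 'e option) \<Rightarrow> nat \<Rightarrow> 'e option" where
  "push e \<equiv> case_nat (Some e)"

text \<open>The arc nearest to the codomain is pushed last and so sits at index 0: a ray is read
  backwards from its base vertex. The base vertex of the argument is discarded, whence the side
  condition on \<open>fst\<close> in the cancellation law.\<close>

fun path_act :: "('v, 'e) path \<Rightarrow> ('v, 'e) ray \<Rightarrow> ('v, 'e) ray" where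
  "path_act (u, p, v) (w, f) = (v, fold push p f)"

fun plen :: "('v, 'e) path \<Rightarrow> nat" where
  "plen (u, p, v) = length p"

lemma push_eq_iff: "push a f = push b g \<longleftrightarrow> a = b \<and> f = g"
proof
  assume eq: "push a f = push b g"
  have "f n = g n" for n using fun_cong[OF eq, of "Suc n"] by simp
  moreover have "a = b" using fun_cong[OF eq, of 0] by simp
  ultimately show "a = b \<and> f = g" by blast
qed simp

text \<open>The last arc of a list is the outermost one in the sequence, so both lists are peeled
  from the end.\<close>

lemma fold_push_eqD:
  assumes "fold push p f = fold push p' f'" "length p \<le> length p'"
  shows "\<exists>q. p' = q @ p \<and> f = fold push q f'"
  using assms
proof (induction p arbitrary: p' rule: rev_induct)
  case (snoc e p)
  then obtain p'' e' where p': "p' = p'' @ [e']" by (cases p' rule: rev_cases) auto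
  with snoc.prems show ?case using snoc.IH[of p''] by (auto simp: push_eq_iff)
qed simp

lemma fst_path_act [simp]: "fst (path_act x w) = pcod x"
  by (cases x; cases w) simp

lemma pcomp_simps [simp]:
  "pdom (pcomp x z) = pdom z" "pcod (pcomp x z) = pcod x" "plen (pcomp x z) = plen x + plen z"
  "path_act (pcomp x z) w = path_act x (path_act z w)"
  by (cases x; cases z; cases w; simp)+

lemma path_act_cancel:
  assumes "path_act x w = path_act x w'" "fst w = fst w'"
  shows "w = w'"
proof (cases x)
  case (fields u p v)
  with assms fold_push_eqD[of p "snd w" p "snd w'"] show ?thesis
    by (cases w; cases w') auto
qed

lemma path_act_eq_length:
  assumes "path_act x w = path_act y w'" "plen x = plen y" "pdom x = pdom y"
  shows "x = y"
  using assms fold_push_eqD[of "fst (snd x)" "snd w" "fst (snd y)" "snd w'"]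
  by (cases x; cases y; cases w; cases w') auto

lemma pcomp_plen_0:
  assumes "plen z = 0" "pdom x = pcod z" "z \<in> paths G"
  shows "pcomp x z = x"
  using assms by (cases x; cases z) (auto simp: paths_def pre_digraph.awalk_def pre_digraph.cas.simps)

definition arc_path :: "('v, 'e) pre_digraph \<Rightarrow> 'e \<Rightarrow> ('v, 'e) path" where
  "arc_path G e = (tail G e, [e], head G e)"

lemma arc_path_simps [simp]:
  "pdom (arc_path G e) = tail G e" "pcod (arc_path G e) = head G e" "plen (arc_path G e) = 1"
  "path_act (arc_path G e) w = (head G e, push e (snd w))"
  by (cases w; simp add: arc_path_def)+

context wf_digraph
begin

lemma arc_path_in_paths [intro]: "e \<in> arcs G \<Longrightarrow> arc_path G e \<in> paths G"
  by (simp add: arc_path_def paths_def arc_implies_awalk)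

lemma pcomp_in_paths [intro]:
  "\<lbrakk>x \<in> paths G; z \<in> paths G; pdom x = pcod z\<rbrakk> \<Longrightarrow> pcomp x z \<in> paths G"
  by (cases x; cases z) (auto simp: paths_def simp del: awalk_append_iff intro: awalk_appendI)

lemma pdom_in_verts: "x \<in> paths G \<Longrightarrow> pdom x \<in> verts G"
  by (cases x) (auto simp: paths_def)

text \<open>Two paths that prefix the same ray agree on their outer arcs, so the longer one is the
  shorter one followed by a remainder. This drives both the product rule and the comparison of
  overlapping symbols.\<close>

lemma path_factor:
  assumes x: "x \<in> paths G" and y: "y \<in> paths G"
    and w: "fst w = pdom x" and eq: "path_act x w = path_act y w'" and len: "plen x \<le> plen y"
  shows "\<exists>z. extends_by G y x z \<and> w = path_act z w'"
proof -
  obtain u p v u' p' where xy: "x = (u, p, v)" "y = (u', p', v)"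
    using eq by (cases x; cases y; cases w; cases w') auto
  then obtain q where q: "p' = q @ p" "snd w = fold push q (snd w')"
    using eq len fold_push_eqD[of p "snd w" p' "snd w'"] by (cases w; cases w') auto
  have "awalk u' q (awlast u' q)" "awalk (awlast u' q) p v" "awalk u p v"
    using x y by (simp_all add: xy q paths_def)
  \<comment> \<open>If p is non-empty, both vertices are the tail of its first arc; if it is empty,
    both are v.\<close>
  moreover from this have "awlast u' q = u"
    by (cases p) (auto simp: awalk_simps)
  ultimately have "(u', q, u) \<in> paths G" by (simp add: paths_def)
  then have "extends_by G y x (u', q, u)" by (simp add: extends_by_def xy q)
  moreover have "w = path_act (u', q, u) w'" using q w xy by (cases w; cases w') simp
  ultimately show ?thesis by blast
qed

lemma no_path_into_source:
  assumes "z \<in> paths G" "in_arcs G (pcod z) = {}"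
  shows "plen z = 0"
proof (cases z)
  case (fields u p v)
  show ?thesis
  proof (cases p rule: rev_cases)
    case (snoc q e)
    then have "e \<in> in_arcs G (pcod z)" using assms(1) fields by (auto simp: paths_def awalk_simps)
    with assms(2) show ?thesis by simp
  qed (use fields in simp)
qed

end

section \<open>Products of symbols and their relations on rays\<close>

lemma extends_by_unique: "extends_by G u y z \<Longrightarrow> extends_by G u y z' \<Longrightarrow> z = z'"
  by (cases u; cases y; cases z; cases z') (auto simp: extends_by_def)

lemma gis_mult_left:
  assumes "extends_by G u y z"
  shows "gis_mult G (Frac x y) (Frac u v) = Frac (pcomp x z) v"
proof -
  have "(THE z. extends_by G u y z) = z" using assms extends_by_unique by (intro the_equality)
  moreover have ex: "\<exists>z. extends_by G u y z" using assms by blast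
  ultimately show ?thesis by (simp only: gis_mult.simps if_P[OF ex] if_True)
qed

text \<open>The definition tries the other factorization first. If both exist, comparing lengths
  shows that both remainders are empty, and then the two branches give the same symbol.\<close>

lemma gis_mult_right:
  assumes z: "extends_by G y u z" and dom: "pdom x = pdom y" "pdom u = pdom v"
  shows "gis_mult G (Frac x y) (Frac u v) = Frac x (pcomp v z)"
proof (cases "\<exists>z'. extends_by G u y z'")
  case True
  then obtain z' where z': "extends_by G u y z'" by blast
  then have "plen y = plen y + plen z' + plen z" using z by (metis extends_by_def pcomp_simps(3))
  then have "plen z = 0" "plen z' = 0" by simp_all
  then have "pcomp x z' = x" "pcomp v z = v"
    using z z' dom by (auto simp: extends_by_def intro!: pcomp_plen_0)
  then show ?thesis using gis_mult_left[OF z'] by simp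
next
  case False
  have "(THE z. extends_by G y u z) = z" using z extends_by_unique by (intro the_equality)
  moreover have ex: "\<exists>z. extends_by G y u z" using z by blast
  ultimately show ?thesis by (simp only: gis_mult.simps if_not_P[OF False] if_P[OF ex] if_True if_False)
qed

text \<open>
  The integer records the lag $|x| - |y|$: without it, distinct symbols such as the powers of a loop
  would act in the same way on an eventually periodic ray. Pairs are (output, input), so that
  products become relational compositions.
\<close>

definition ray_rel :: "('v, 'e) ray set \<Rightarrow> ('v, 'e) gis \<Rightarrow> (('v, 'e) ray \<times> int) rel" where
  "ray_rel W s = (case s of Null \<Rightarrow> {} | Frac x y \<Rightarrow>
     {((path_act x w, n + int (plen x)), (path_act y w, n + int (plen y))) | w n.
        w \<in> W \<and> fst w = pdom x})"

lemma ray_rel_Null [simp]: "ray_rel W Null = {}"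
  by (simp add: ray_rel_def)

lemma ray_rel_Frac:
  "ray_rel W (Frac x y) =
     {((path_act x w, n + int (plen x)), (path_act y w, n + int (plen y))) | w n.
        w \<in> W \<and> fst w = pdom x}"
  by (simp add: ray_rel_def)

lemma ray_relI:
  assumes "w \<in> W" "fst w = pdom x"
    and "p = (path_act x w, n + int (plen x))" "q = (path_act y w, n + int (plen y))"
  shows "(p, q) \<in> ray_rel W (Frac x y)"
  unfolding ray_rel_Frac using assms by blast

lemma ray_relE:
  assumes "(p, q) \<in> ray_rel W (Frac x y)"
  obtains w n where "w \<in> W" "fst w = pdom x"
    "p = (path_act x w, n + int (plen x))" "q = (path_act y w, n + int (plen y))"
  using assms unfolding ray_rel_Frac by blast

lemma ray_rel_swap:
  assumes "pdom x = pdom y"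
  shows "ray_rel W (Frac y x) = (ray_rel W (Frac x y))\<inverse>"
  using assms by (auto simp: ray_rel_Frac)

lemma partial_injection_ray_rel:
  assumes "pdom x = pdom y"
  shows "partial_injection (ray_rel W (Frac x y))"
proof -
  have right: "q = q'"
    if pq: "(p, q) \<in> ray_rel W (Frac x y)" and pq': "(p, q') \<in> ray_rel W (Frac x y)" for p q q' x y
  proof -
    obtain w n where 1: "fst w = pdom x" "p = (path_act x w, n + int (plen x))"
      "q = (path_act y w, n + int (plen y))" using pq by (elim ray_relE)
    obtain w' n' where 2: "fst w' = pdom x" "p = (path_act x w', n' + int (plen x))"
      "q' = (path_act y w', n' + int (plen y))" using pq' by (elim ray_relE)
    have "w = w'" using path_act_cancel[of x w w'] 1 2 by simp
    with 1 2 show ?thesis by simp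
  qed
  have left: "p = p'"
    if "(p, q) \<in> ray_rel W (Frac x y)" "(p', q) \<in> ray_rel W (Frac x y)" for p p' q
  proof (rule right)
    show "(q, p) \<in> ray_rel W (Frac y x)" "(q, p') \<in> ray_rel W (Frac y x)"
      using that by (simp_all add: ray_rel_swap[OF assms])
  qed
  show ?thesis using right left by (rule partial_injectionI)
qed

abbreviation is_frac :: "('v, 'e) pre_digraph \<Rightarrow> ('v, 'e) path \<Rightarrow> ('v, 'e) path \<Rightarrow> bool" where
  "is_frac G x y \<equiv> x \<in> paths G \<and> y \<in> paths G \<and> pdom x = pdom y"

lemma carrier_gis:
  "s \<in> carrier (graph_inverse_semigroup G) \<longleftrightarrow> s = Null \<or> (\<exists>x y. s = Frac x y \<and> is_frac G x y)"
  by (auto simp: graph_inverse_semigroup_def)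

lemma gis_simps [simp]:
  "s \<cdot>\<^bsub>graph_inverse_semigroup G\<^esub> t = gis_mult G s t"
  "\<o>\<^bsub>graph_inverse_semigroup G\<^esub> = Null"
  by (simp_all add: graph_inverse_semigroup_def)

section \<open>The representation on an invariant set of rays\<close>

text \<open>\<open>W\<close> is a parameter because it is instantiated twice: with all rays for
  faithfulness and with boundary rays for tightness.\<close>

locale ray_action = wf_digraph +
  fixes W :: "('a, 'b) ray set"
  assumes act_closed: "\<lbrakk>z \<in> paths G; w \<in> W; fst w = pdom z\<rbrakk> \<Longrightarrow> path_act z w \<in> W"
    and ray_exists: "v \<in> verts G \<Longrightarrow> \<exists>w \<in> W. fst w = v"
begin

text \<open>The intermediate ray is uw = y(zw), with integer n + |u| = (n + |z|) + |y|. In the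
  converse direction, cancelling y shows that the first ray is z applied to the second.\<close>

lemma ray_rel_left:
  assumes xy: "is_frac G x y" and uv: "is_frac G u v" and z: "extends_by G u y z"
  shows "ray_rel W (Frac (pcomp x z) v) = ray_rel W (Frac x y) O ray_rel W (Frac u v)"
proof (intro equalityI subrelI)
  fix p q assume "(p, q) \<in> ray_rel W (Frac (pcomp x z) v)"
  then obtain w n where w: "w \<in> W" "fst w = pdom z"
    and p: "p = (path_act x (path_act z w), n + int (plen z) + int (plen x))"
    and q: "q = (path_act v w, n + int (plen v))"
    by (elim ray_relE) (simp add: algebra_simps)
  let ?m = "(path_act u w, n + int (plen u))"
  have "(p, ?m) \<in> ray_rel W (Frac x y)"
    using w z xy act_closed[of z w]
    by (intro ray_relI[where w = "path_act z w" and n = "n + int (plen z)"])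
      (simp_all add: p extends_by_def)
  moreover have "(?m, q) \<in> ray_rel W (Frac u v)"
    using w z by (intro ray_relI[where w = w]) (simp_all add: q extends_by_def)
  ultimately show "(p, q) \<in> ray_rel W (Frac x y) O ray_rel W (Frac u v)" by blast
next
  fix p q assume "(p, q) \<in> ray_rel W (Frac x y) O ray_rel W (Frac u v)"
  then obtain w1 n1 w2 n2 where w: "w1 \<in> W" "fst w1 = pdom x" "w2 \<in> W" "fst w2 = pdom u"
    and p: "p = (path_act x w1, n1 + int (plen x))"
    and q: "q = (path_act v w2, n2 + int (plen v))"
    and mid: "path_act y w1 = path_act u w2" "n1 + int (plen y) = n2 + int (plen u)"
    by (elim relcompE ray_relE) (simp, metis)
  have u: "u = pcomp y z" "pdom y = pcod z" using z by (simp_all add: extends_by_def)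
  have "w1 = path_act z w2"
    using path_act_cancel[of y w1 "path_act z w2"] mid(1) u w xy by simp
  moreover have "n1 = n2 + int (plen z)" using mid(2) u by simp
  ultimately show "(p, q) \<in> ray_rel W (Frac (pcomp x z) v)"
    using w u by (intro ray_relI[where w = w2 and n = n2]) (simp_all add: p q)
qed

text \<open>The second case is the converse relation of the first. In the last case, an intermediate
  ray would have both y and u as prefixes, so one of them would extend the other.\<close>

lemma ray_rel_mult:
  assumes xy: "is_frac G x y" and uv: "is_frac G u v"
  shows "ray_rel W (gis_mult G (Frac x y) (Frac u v)) = ray_rel W (Frac x y) O ray_rel W (Frac u v)"
proof -
  consider z where "extends_by G u y z" | z where "extends_by G y u z"
    | "\<nexists>z. extends_by G u y z" "\<nexists>z. extends_by G y u z" by blast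
  then show ?thesis
  proof cases
    case 1
    then show ?thesis using gis_mult_left ray_rel_left[OF xy uv] by metis
  next
    case (2 z)
    have "ray_rel W (Frac x (pcomp v z)) = (ray_rel W (Frac (pcomp v z) x))\<inverse>"
      using 2 xy by (intro ray_rel_swap) (simp add: extends_by_def)
    also have "ray_rel W (Frac (pcomp v z) x) = ray_rel W (Frac v u) O ray_rel W (Frac y x)"
      using xy uv 2 by (intro ray_rel_left) simp_all
    also have "\<dots>\<inverse> = ray_rel W (Frac x y) O ray_rel W (Frac u v)"
      using xy uv ray_rel_swap[of y x W] ray_rel_swap[of v u W] by (simp add: converse_relcomp)
    finally show ?thesis using gis_mult_right[OF 2] xy uv by simp
  next
    case 3
    have "False" if pq: "(p, q) \<in> ray_rel W (Frac x y) O ray_rel W (Frac u v)" for p q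
    proof -
      obtain w1 w2 where w: "path_act y w1 = path_act u w2" "fst w1 = pdom y" "fst w2 = pdom u"
        using pq xy by (elim relcompE ray_relE) (simp, metis)
      have "plen y \<le> plen u \<or> plen u \<le> plen y" by linarith
      then show False
        using 3 path_factor[of y u w1 w2] path_factor[of u y w2 w1] w xy uv by metis
    qed
    then have "ray_rel W (Frac x y) O ray_rel W (Frac u v) = {}"
      by (intro equals0I) (metis surj_pair)
    then show ?thesis by (simp only: gis_mult.simps if_not_P[OF 3(1)] if_not_P[OF 3(2)] if_True if_False ray_rel_Null)
  qed
qed

lemma gis_mult_closed:
  assumes "s \<in> carrier (graph_inverse_semigroup G)" "t \<in> carrier (graph_inverse_semigroup G)"
  shows "gis_mult G s t \<in> carrier (graph_inverse_semigroup G)"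
proof (cases "s = Null \<or> t = Null")
  case True
  then show ?thesis by (cases s) (auto simp: carrier_gis)
next
  case False
  then obtain x y u v where s: "s = Frac x y" "is_frac G x y" and t: "t = Frac u v" "is_frac G u v"
    using assms unfolding carrier_gis by blast
  consider z where "extends_by G u y z" | z where "extends_by G y u z"
    | "\<nexists>z. extends_by G u y z" "\<nexists>z. extends_by G y u z" by blast
  then show ?thesis
  proof cases
    case (1 z)
    then have "is_frac G (pcomp x z) v" using s t by (auto simp: extends_by_def)
    then show ?thesis using gis_mult_left[OF 1] by (simp add: s t carrier_gis)
  next
    case (2 z)
    then have "is_frac G x (pcomp v z)" using s t by (auto simp: extends_by_def)
    then show ?thesis using gis_mult_right[OF 2] s t by (simp add: carrier_gis)
  next
    case 3
    then show ?thesis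
      by (simp only: s(1) t(1) gis_mult.simps if_not_P[OF 3(1)] if_not_P[OF 3(2)] if_True if_False carrier_gis simp_thms)
  qed
qed

lemma ray_rep: "partial_injection_rep (graph_inverse_semigroup G) (ray_rel W)"
proof
  fix s t
  assume st: "s \<in> carrier (graph_inverse_semigroup G)" "t \<in> carrier (graph_inverse_semigroup G)"
  then show "s \<cdot>\<^bsub>graph_inverse_semigroup G\<^esub> t \<in> carrier (graph_inverse_semigroup G)"
    by (simp add: gis_mult_closed)
  show "ray_rel W (s \<cdot>\<^bsub>graph_inverse_semigroup G\<^esub> t) = ray_rel W s O ray_rel W t"
    using st ray_rel_mult unfolding carrier_gis by (cases s) (auto simp del: gis_mult.simps(1))
next
  fix s assume s: "s \<in> carrier (graph_inverse_semigroup G)"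
  then show "partial_injection (ray_rel W s)"
    by (cases s) (simp_all add: carrier_gis partial_injection_ray_rel, simp add: partial_injection_def)
  show "\<exists>t\<in>carrier (graph_inverse_semigroup G). ray_rel W t = (ray_rel W s)\<inverse>"
  proof (cases s)
    case Null
    then show ?thesis using s by (intro bexI[of _ s]) simp_all
  next
    case (Frac x y)
    then have "is_frac G x y" using s by (simp add: carrier_gis)
    then show ?thesis
      using ray_rel_swap[of x y W] by (intro bexI[of _ "Frac y x"]) (simp_all add: Frac carrier_gis)
  qed
qed (simp_all add: carrier_gis)

lemma ray_rel_nonempty: "is_frac G x y \<Longrightarrow> ray_rel W (Frac x y) \<noteq> {}"
  using ray_exists[OF pdom_in_verts[of x]] ray_relI by (metis empty_iff)

lemma ray_rel_empty_iff:
  "s \<in> carrier (graph_inverse_semigroup G) \<Longrightarrow> ray_rel W s = {} \<longleftrightarrow> s = Null"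
  by (cases s) (simp_all add: carrier_gis ray_rel_nonempty)

lemma ray_rel_extend_subset:
  assumes "is_frac G x y" "z \<in> paths G" "pdom x = pcod z"
  shows "ray_rel W (Frac (pcomp x z) (pcomp y z)) \<subseteq> ray_rel W (Frac x y)"
proof (rule subrelI)
  fix p q assume "(p, q) \<in> ray_rel W (Frac (pcomp x z) (pcomp y z))"
  then obtain w n where w: "w \<in> W" "fst w = pdom z"
    and "p = (path_act x (path_act z w), (n + int (plen z)) + int (plen x))"
      "q = (path_act y (path_act z w), (n + int (plen z)) + int (plen y))"
    by (elim ray_relE) (simp add: algebra_simps)
  moreover have "path_act z w \<in> W" using w assms by (intro act_closed)
  ultimately show "(p, q) \<in> ray_rel W (Frac x y)"
    using assms(3) by (intro ray_relI[where w = "path_act z w"]) simp_all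
qed

text \<open>A common point makes x and u comparable, and likewise y and v. The integers then say
  that both extensions have the same length, so a single path z extends both components.\<close>

lemma ray_rel_meets:
  assumes xy: "is_frac G x y" and uv: "is_frac G u v"
    and ne: "ray_rel W (Frac x y) \<inter> ray_rel W (Frac u v) \<noteq> {}"
  obtains z where "z \<in> paths G" "pdom x = pcod z" "u = pcomp x z" "v = pcomp y z"
  | z where "z \<in> paths G" "pdom u = pcod z" "x = pcomp u z" "y = pcomp v z"
proof -
  have *: "\<exists>z. z \<in> paths G \<and> pdom x = pcod z \<and> u = pcomp x z \<and> v = pcomp y z"
    if xy: "is_frac G x y" and uv: "is_frac G u v" and w: "fst w = pdom x" "fst w' = pdom u"
      and eq: "path_act x w = path_act u w'" "path_act y w = path_act v w'"
      and len: "plen x \<le> plen u" "int (plen u) - int (plen x) = int (plen v) - int (plen y)"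
    for x y u v :: "('a, 'b) path" and w w'
  proof -
    obtain z where z: "extends_by G u x z" "w = path_act z w'"
      using path_factor[of x u w w'] xy uv w eq len by metis
    have "plen y \<le> plen v" "fst w = pdom y" using len w xy by simp_all
    then obtain z' where z': "extends_by G v y z'" "w = path_act z' w'"
      using path_factor[of y v w w'] xy uv eq by metis
    \<comment> \<open>Here the lag matters: on a periodic ray, z and z' could otherwise be different
      powers of a loop.\<close>
    have "plen z = plen z'" using len z z' by (simp add: extends_by_def)
    moreover have "pdom z = pdom z'" using z z' uv by (simp add: extends_by_def)
    ultimately have "z = z'" using z z' path_act_eq_length[of z w' z' w'] by simp
    then show ?thesis using z(1) z'(1) by (intro exI[of _ z]) (simp add: extends_by_def)
  qed
  obtain p q where pq: "(p, q) \<in> ray_rel W (Frac x y)" and pq': "(p, q) \<in> ray_rel W (Frac u v)"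
    using ne by (metis IntE all_not_in_conv surj_pair)
  obtain w n where 1: "fst w = pdom x" "p = (path_act x w, n + int (plen x))"
    "q = (path_act y w, n + int (plen y))" using pq by (elim ray_relE)
  obtain w' n' where 2: "fst w' = pdom u" "p = (path_act u w', n' + int (plen u))"
    "q = (path_act v w', n' + int (plen v))" using pq' by (elim ray_relE)
  note w = 1(1) 2(1)
  have eq: "path_act x w = path_act u w'" "path_act y w = path_act v w'"
    and n: "n + int (plen x) = n' + int (plen u)" "n + int (plen y) = n' + int (plen v)"
    using 1 2 by simp_all
  show thesis
  proof (cases "plen x \<le> plen u")
    case True
    then have "\<exists>z. z \<in> paths G \<and> pdom x = pcod z \<and> u = pcomp x z \<and> v = pcomp y z"
      using n by (intro *[OF xy uv w eq]) simp_all
    with that(1) show thesis by blast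
  next
    case False
    then have "\<exists>z. z \<in> paths G \<and> pdom u = pcod z \<and> x = pcomp u z \<and> y = pcomp v z"
      using n by (intro *[OF uv xy w(2,1) eq[symmetric]]) simp_all
    with that(2) show thesis by blast
  qed
qed

end

lemma (in wf_digraph) ray_action_UNIV: "ray_action G UNIV"
  by unfold_locales auto

text \<open>Symbols with equal relations overlap, so one extends the other by some z. A ray that
  stops immediately after the shorter prefix shows that z is empty.\<close>

lemma (in wf_digraph) faithful_ray_rep:
  "faithful_rep (graph_inverse_semigroup G) (ray_rel UNIV)"
proof -
  interpret U: ray_action G UNIV by (rule ray_action_UNIV)
  have extend_eq: "plen z = 0"
    if "is_frac G x y" "z \<in> paths G" "pdom x = pcod z"
      and sub: "ray_rel UNIV (Frac x y) \<subseteq> ray_rel UNIV (Frac (pcomp x z) (pcomp y z))" for x y z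
  proof -
    \<comment> \<open>The sequence without arcs, which no path of positive length can produce as a
      prefixed ray.\<close>
    let ?w = "(pdom x, \<lambda>_. None)"
    have "((path_act x ?w, int (plen x)), (path_act y ?w, int (plen y))) \<in> ray_rel UNIV (Frac x y)"
      by (rule ray_relI[where w = ?w and n = 0]) simp_all
    from subsetD[OF sub this] obtain w where "path_act x ?w = path_act x (path_act z w)"
      by (elim ray_relE) simp
    then have "?w = path_act z w" using path_act_cancel[of x ?w "path_act z w"] that(3) by simp
    then show "plen z = 0"
      by (cases z; cases w; cases "fst (snd z)" rule: rev_cases)
        (auto dest: fun_cong[where x = 0])
  qed
  have frac_eq: "Frac x y = Frac u v"
    if xy: "is_frac G x y" and uv: "is_frac G u v"
      and eq: "ray_rel UNIV (Frac x y) = ray_rel UNIV (Frac u v)" for x y u v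
  proof -
    have "ray_rel UNIV (Frac x y) \<inter> ray_rel UNIV (Frac u v) \<noteq> {}"
      using U.ray_rel_nonempty[OF xy] eq by simp
    from xy uv this show ?thesis
    proof (cases rule: U.ray_rel_meets)
      case (1 z)
      then have "plen z = 0" using extend_eq[OF xy, of z] eq by simp
      then show ?thesis using 1 xy pcomp_plen_0 by metis
    next
      case (2 z)
      then have "plen z = 0" using extend_eq[OF uv, of z] eq by simp
      then show ?thesis using 2 uv pcomp_plen_0 by metis
    qed
  qed
  interpret partial_injection_rep "graph_inverse_semigroup G" "ray_rel UNIV" by (rule U.ray_rep)
  show ?thesis
  proof
    show "inj_on (ray_rel UNIV) (carrier (graph_inverse_semigroup G))"
    proof (rule inj_onI)
      fix s t :: "('a, 'b) gis"
      assume s: "s \<in> carrier (graph_inverse_semigroup G)"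
        and t: "t \<in> carrier (graph_inverse_semigroup G)" and eq: "ray_rel UNIV s = ray_rel UNIV t"
      show "s = t"
      proof (cases "s = Null \<or> t = Null")
        case True
        then show ?thesis using U.ray_rel_empty_iff[OF s] U.ray_rel_empty_iff[OF t] eq by auto
      next
        case False
        then obtain x y u v where "s = Frac x y" "t = Frac u v" by (metis gis.exhaust)
        then show ?thesis using s t eq frac_eq by (simp add: carrier_gis)
      qed
    qed
  qed
qed

section \<open>Boundary rays\<close>

text \<open>Coinduction admits the infinite sequences. A finite one is padded with
  \<open>None\<close>, and the base rule lets it stop only at a vertex without incoming
  arcs.\<close>

coinductive boundary :: "('v, 'e) pre_digraph \<Rightarrow> 'v \<Rightarrow> (nat \<Rightarrow> 'e option) \<Rightarrow> bool"
  for G :: "('v, 'e) pre_digraph" where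
  source: "v \<in> verts G \<Longrightarrow> in_arcs G v = {} \<Longrightarrow> boundary G v (\<lambda>_. None)"
| step: "e \<in> arcs G \<Longrightarrow> boundary G (tail G e) f \<Longrightarrow> boundary G (head G e) (push e f)"

definition boundary_rays :: "('v, 'e) pre_digraph \<Rightarrow> ('v, 'e) ray set" where
  "boundary_rays G = {(v, f). boundary G v f}"

text \<open>Walks backwards along chosen incoming arcs as long as there are any. It provides a
  boundary ray at every vertex, so that non-zero symbols have non-empty relations.\<close>

primrec some_ray :: "('v, 'e) pre_digraph \<Rightarrow> nat \<Rightarrow> 'v \<Rightarrow> 'e option" where
  "some_ray G 0 v = (if in_arcs G v = {} then None else Some (SOME e. e \<in> in_arcs G v))"
| "some_ray G (Suc n) v =
     (if in_arcs G v = {} then None else some_ray G n (tail G (SOME e. e \<in> in_arcs G v)))"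

context wf_digraph
begin

lemma boundary_some_ray: "v \<in> verts G \<Longrightarrow> boundary G v (\<lambda>n. some_ray G n v)"
proof -
  assume "v \<in> verts G"
  then have "v \<in> verts G \<and> (\<lambda>n. some_ray G n v) = (\<lambda>n. some_ray G n v)" by simp
  then show ?thesis
  proof (coinduction arbitrary: v rule: boundary.coinduct)
    case boundary
    show ?case
    proof (cases "in_arcs G v = {}")
      case True
      have "some_ray G n v = None" for n using True by (cases n) simp_all
      with True boundary show ?thesis by simp
    next
      case False
      let ?e = "SOME e. e \<in> in_arcs G v"
      have e: "?e \<in> in_arcs G v" using False unfolding some_in_eq .
      have "(\<lambda>n. some_ray G n v) = push ?e (\<lambda>n. some_ray G n (tail G ?e))"
      proof
        fix n show "some_ray G n v = push ?e (\<lambda>n. some_ray G n (tail G ?e)) n"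
          using False by (cases n) simp_all
      qed
      moreover have "?e \<in> arcs G" "head G ?e = v" using e by simp_all
      moreover have "tail G ?e \<in> verts G" using \<open>?e \<in> arcs G\<close> by simp
      ultimately show ?thesis by metis
    qed
  qed
qed

lemma boundary_fold_push: "awalk u p v \<Longrightarrow> boundary G u f \<Longrightarrow> boundary G v (fold push p f)"
proof (induction p arbitrary: u f)
  case (Cons e p)
  then have "e \<in> arcs G" "u = tail G e" "awalk (head G e) p v" by (simp_all add: awalk_Cons_iff)
  then show ?case using Cons boundary.step[of e G f] by simp
qed (simp add: awalk_Nil_iff)

lemma ray_action_boundary: "ray_action G (boundary_rays G)"
proof unfold_locales
  fix z w assume "z \<in> paths G" "w \<in> boundary_rays G" "fst w = pdom z"
  then show "path_act z w \<in> boundary_rays G"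
    by (cases z; cases w) (simp add: boundary_rays_def paths_def boundary_fold_push)
next
  fix v assume "v \<in> verts G"
  then have "(v, \<lambda>n. some_ray G n v) \<in> boundary_rays G"
    by (simp add: boundary_rays_def boundary_some_ray)
  then show "\<exists>w \<in> boundary_rays G. fst w = v" by force
qed

lemma boundary_ray_uncons:
  assumes w: "w \<in> boundary_rays G" and ne: "in_arcs G (fst w) \<noteq> {}"
  obtains e w' where "e \<in> arcs G" "head G e = fst w" "w' \<in> boundary_rays G" "fst w' = tail G e"
    "w = path_act (arc_path G e) w'"
proof -
  have "boundary G (fst w) (snd w)" using w by (auto simp: boundary_rays_def)
  then show thesis
  proof cases
    case source
    with ne show thesis by simp
  next
    case (step e f)
    then show thesis
      by (intro that[of e "(tail G e, f)"]) (simp_all add: boundary_rays_def prod_eq_iff)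
  qed
qed

text \<open>Either the first n arcs can be split off, or the ray stops earlier at a vertex into
  which no arc leads. In both cases the prefix is long enough to decide membership in a cylinder of
  depth n.\<close>

lemma boundary_ray_split:
  assumes "w \<in> boundary_rays G"
  shows "\<exists>z w'. z \<in> paths G \<and> pcod z = fst w \<and> w' \<in> boundary_rays G \<and> fst w' = pdom z \<and>
    w = path_act z w' \<and> (plen z = n \<or> in_arcs G (pdom z) = {})"
  using assms
proof (induction n arbitrary: w)
  case 0
  have "boundary G (fst w) (snd w)" using 0 by (auto simp: boundary_rays_def)
  then have "fst w \<in> verts G" by cases auto
  then have "(fst w, [], fst w) \<in> paths G" by (simp add: paths_def awalk_Nil_iff)
  moreover have "w = path_act (fst w, [], fst w) w" by (cases w) simp
  ultimately show ?case using 0 by (metis list.size(3) pcod.simps pdom.simps plen.simps)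
next
  case (Suc n)
  show ?case
  proof (cases "in_arcs G (fst w) = {}")
    case True
    have "boundary G (fst w) (snd w)" using Suc.prems by (auto simp: boundary_rays_def)
    then have "fst w \<in> verts G" by cases auto
    then have "(fst w, [], fst w) \<in> paths G" by (simp add: paths_def awalk_Nil_iff)
    moreover have "w = path_act (fst w, [], fst w) w" by (cases w) simp
    ultimately show ?thesis using True Suc.prems by (metis pcod.simps pdom.simps)
  next
    case False
    with Suc.prems obtain e w1 where e: "e \<in> arcs G" "head G e = fst w" "w1 \<in> boundary_rays G"
      "fst w1 = tail G e" "w = path_act (arc_path G e) w1" by (rule boundary_ray_uncons)
    obtain z w' where z: "z \<in> paths G" "pcod z = fst w1" "w' \<in> boundary_rays G" "fst w' = pdom z"
      "w1 = path_act z w'" "plen z = n \<or> in_arcs G (pdom z) = {}" using Suc.IH[OF e(3)] by blast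
    have "pcomp (arc_path G e) z \<in> paths G" using e(1,4) z(1,2)
      by (intro pcomp_in_paths arc_path_in_paths) simp_all
    moreover have "w = path_act (pcomp (arc_path G e) z) w'" unfolding pcomp_simps e(5) z(5) ..
    moreover have "plen (pcomp (arc_path G e) z) = Suc n \<or> in_arcs G (pdom (pcomp (arc_path G e) z)) = {}"
      using z(6) by simp
    ultimately show ?thesis
      using z(3,4) e(2) by (intro exI[of _ "pcomp (arc_path G e) z"] exI[of _ w'] conjI) simp_all
  qed
qed

lemma tight_ray_rep:
  "tight_rep (graph_inverse_semigroup G) (ray_rel UNIV) (ray_rel (boundary_rays G))"
proof -
  interpret U: ray_action G UNIV by (rule ray_action_UNIV)
  interpret B: ray_action G "boundary_rays G" by (rule ray_action_boundary)
  interpret F: faithful_rep "graph_inverse_semigroup G" "ray_rel UNIV" by (rule faithful_ray_rep)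
  interpret P: partial_injection_rep "graph_inverse_semigroup G" "ray_rel (boundary_rays G)"
    by (rule B.ray_rep)
  have extend_le: "nat_le (graph_inverse_semigroup G) (Frac (pcomp x z) (pcomp y z)) (Frac x y)"
    if "is_frac G x y" "z \<in> paths G" "pdom x = pcod z" for x y z
  proof -
    have "is_frac G (pcomp x z) (pcomp y z)" using that by auto
    with that show ?thesis
      using U.ray_rel_extend_subset[OF that] by (simp add: F.nat_le_iff carrier_gis)
  qed
  show ?thesis
  proof
    fix s assume "s \<in> carrier (graph_inverse_semigroup G)" "ray_rel (boundary_rays G) s = {}"
    then show "s = \<o>\<^bsub>graph_inverse_semigroup G\<^esub>" using B.ray_rel_empty_iff by simp
  next
    fix s t
    assume st: "s \<in> carrier (graph_inverse_semigroup G)" "t \<in> carrier (graph_inverse_semigroup G)"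
      and ne: "ray_rel (boundary_rays G) s \<inter> ray_rel (boundary_rays G) t \<noteq> {}"
    obtain x y u v where eqs: "s = Frac x y" "t = Frac u v"
      using ne by (cases s; cases t) auto
    have xy: "is_frac G x y" and uv: "is_frac G u v" using st by (simp_all add: eqs carrier_gis)
    from xy uv ne[unfolded eqs]
    show "nat_le (graph_inverse_semigroup G) s t \<or> nat_le (graph_inverse_semigroup G) t s"
    proof (cases rule: B.ray_rel_meets)
      case (1 z)
      then show ?thesis using extend_le[OF xy, of z] by (simp add: eqs)
    next
      case (2 z)
      then show ?thesis using extend_le[OF uv, of z] by (simp add: eqs)
    qed
  next
    fix a b r
    assume a: "a \<in> carrier (graph_inverse_semigroup G)" and b: "b \<in> carrier (graph_inverse_semigroup G)"
      and r: "r \<in> ray_rel (boundary_rays G) a"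
    obtain x y where a_eq: "a = Frac x y" using r by (cases a) auto
    have xy: "is_frac G x y" using a by (simp add: a_eq carrier_gis)
    obtain p q where pq: "r = (p, q)" by (cases r)
    then obtain w n where w: "w \<in> boundary_rays G" "fst w = pdom x"
      and p: "p = (path_act x w, n + int (plen x))" and q: "q = (path_act y w, n + int (plen y))"
      using r ray_relE unfolding a_eq by metis
    \<comment> \<open>For b = uv^-1, lengthening x by N arcs makes it at least as long as u, so that
      b cannot properly refine the new symbol.\<close>
    define N where "N = (case b of Null \<Rightarrow> 0 | Frac u v \<Rightarrow> plen u)"
    obtain z w' where z: "z \<in> paths G" "pcod z = pdom x" "w' \<in> boundary_rays G" "fst w' = pdom z"
      "w = path_act z w'" "plen z = N \<or> in_arcs G (pdom z) = {}"
      using boundary_ray_split[OF w(1), of N] w(2) by auto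
    let ?s = "Frac (pcomp x z) (pcomp y z)"
    have xz: "is_frac G (pcomp x z) (pcomp y z)" using xy z by auto
    have le: "nat_le (graph_inverse_semigroup G) ?s a"
      unfolding a_eq using xy z by (intro extend_le) simp_all
    \<comment> \<open>Moving z from the ray into the prefix adds |z| to the integer, which the shift
      of n undoes.\<close>
    have mem: "r \<in> ray_rel (boundary_rays G) ?s"
      unfolding pq using z by (intro ray_relI[where w = w' and n = "n - int (plen z)"]) (simp_all add: p q)
    have "ray_rel (boundary_rays G) ?s \<subseteq> ray_rel (boundary_rays G) b"
      if ne: "ray_rel (boundary_rays G) ?s \<inter> ray_rel (boundary_rays G) b \<noteq> {}"
    proof -
      obtain u v where b_eq: "b = Frac u v" using ne by (cases b) auto
      have uv: "is_frac G u v" using b by (simp add: b_eq carrier_gis)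
      from xz uv ne[unfolded b_eq] show ?thesis
      proof (cases rule: B.ray_rel_meets)
        case (1 t)
        \<comment> \<open>From u = xzt, either |z| = |u| leaves no room for t, or t would enter a
          vertex without incoming arcs.\<close>
        have "plen t = 0"
          using z(6)
        proof
          assume "plen z = N"
          then show ?thesis using 1 by (simp add: N_def b_eq)
        next
          assume "in_arcs G (pdom z) = {}"
          then show ?thesis using 1 by (intro no_path_into_source) simp_all
        qed
        then have "pcomp (pcomp x z) t = pcomp x z" "pcomp (pcomp y z) t = pcomp y z"
          using 1 by (intro pcomp_plen_0[where G = G]; simp)+
        then show ?thesis using 1 by (simp add: b_eq)
      next
        case (2 t)
        then show ?thesis using B.ray_rel_extend_subset[OF uv, of t] by (simp add: b_eq)
      qed
    qed
    then have "ray_rel (boundary_rays G) ?s \<subseteq> ray_rel (boundary_rays G) b \<or>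
        ray_rel (boundary_rays G) ?s \<inter> ray_rel (boundary_rays G) b = {}" by metis
    then show "\<exists>s. nat_le (graph_inverse_semigroup G) s a \<and> r \<in> ray_rel (boundary_rays G) s \<and>
        (ray_rel (boundary_rays G) s \<subseteq> ray_rel (boundary_rays G) b \<or>
         ray_rel (boundary_rays G) s \<inter> ray_rel (boundary_rays G) b = {})"
      using le mem by (intro exI[of _ ?s] conjI)
  qed
qed

end

section \<open>Differences of cylinders when in-degrees are finite\<close>

locale finite_in_degree_digraph = wf_digraph +
  assumes finite_in_arcs: "v \<in> verts G \<Longrightarrow> finite (in_arcs G v)"
begin

interpretation B: ray_action G "boundary_rays G" by (rule ray_action_boundary)

abbreviation cyl :: "('a, 'b) path \<Rightarrow> (('a, 'b) ray \<times> int) rel" where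
  "cyl x \<equiv> ray_rel (boundary_rays G) (Frac x x)"

lemma cyl_subset_Id: "cyl x \<subseteq> Id"
  by (rule subrelI) (elim ray_relE, simp)

lemma cyl_pcomp_subset: "\<lbrakk>x \<in> paths G; z \<in> paths G; pdom x = pcod z\<rbrakk> \<Longrightarrow> cyl (pcomp x z) \<subseteq> cyl x"
  by (intro B.ray_rel_extend_subset) simp_all

text \<open>A boundary ray may not stop at the domain of y, since a enters there. It continues
  through exactly one arc b, and cancelling y recovers b from the ray.\<close>

lemma cyl_diff_arc:
  assumes y: "y \<in> paths G" and a: "a \<in> arcs G" "head G a = pdom y"
  shows "cyl y - cyl (pcomp y (arc_path G a)) =
    (\<Union>b \<in> in_arcs G (pdom y) - {a}. cyl (pcomp y (arc_path G b)))"
proof (intro equalityI subrelI)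
  fix p q assume pq: "(p, q) \<in> cyl y - cyl (pcomp y (arc_path G a))"
  then have "(p, q) \<in> cyl y" by simp
  then obtain w n where w: "w \<in> boundary_rays G" "fst w = pdom y"
    "p = (path_act y w, n + int (plen y))" "q = (path_act y w, n + int (plen y))"
    by (rule ray_relE)
  have "in_arcs G (fst w) \<noteq> {}" using a w(2) by (metis empty_iff in_in_arcs_conv)
  with w(1) obtain b w' where b: "b \<in> arcs G" "head G b = fst w" "w' \<in> boundary_rays G"
    "fst w' = tail G b" "w = path_act (arc_path G b) w'" by (rule boundary_ray_uncons)
  \<comment> \<open>The integer drops by one because the arc b now belongs to the prefix.\<close>
  have mem: "(p, q) \<in> cyl (pcomp y (arc_path G b))"
    using b(3,4) w(3,4) unfolding b(5)
    by (intro ray_relI[where w = w' and n = "n - 1"]) simp_all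
  then have "b \<noteq> a" using pq by auto
  moreover have "b \<in> in_arcs G (pdom y)" using b(1,2) w(2) by simp
  ultimately show "(p, q) \<in> (\<Union>b \<in> in_arcs G (pdom y) - {a}. cyl (pcomp y (arc_path G b)))"
    using mem by (intro UN_I[of b]) simp_all
next
  fix p q assume "(p, q) \<in> (\<Union>b \<in> in_arcs G (pdom y) - {a}. cyl (pcomp y (arc_path G b)))"
  then obtain b where b: "b \<in> arcs G" "head G b = pdom y" "b \<noteq> a"
    and mem: "(p, q) \<in> cyl (pcomp y (arc_path G b))" by (elim UN_E) (metis Diff_iff in_in_arcs_conv singletonI)
  have "cyl (pcomp y (arc_path G b)) \<subseteq> cyl y"
    using b y by (intro cyl_pcomp_subset arc_path_in_paths) simp_all
  moreover have "(p, q) \<notin> cyl (pcomp y (arc_path G a))"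
  proof
    assume mem': "(p, q) \<in> cyl (pcomp y (arc_path G a))"
    obtain w n where 1: "p = (path_act (pcomp y (arc_path G b)) w, n)" using mem by (elim ray_relE) blast
    obtain w' n' where 2: "p = (path_act (pcomp y (arc_path G a)) w', n')" using mem' by (elim ray_relE) blast
    have "path_act y (head G b, push b (snd w)) = path_act y (head G a, push a (snd w'))"
      using 1 2 by simp
    then have "(head G b, push b (snd w)) = (head G a, push a (snd w'))"
      by (rule path_act_cancel) (simp add: a b)
    then show False using b by (simp add: push_eq_iff)
  qed
  ultimately show "(p, q) \<in> cyl y - cyl (pcomp y (arc_path G a))" using mem by auto
qed

text \<open>The head of the arc list is the arc farthest from x. Removing it gives an intermediate
  path y, and the difference splits into that of x and y, known by induction, and the one-arc
  difference at y.\<close>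

lemma cyl_diff_pcomp:
  assumes "x \<in> paths G" "awalk d p (pdom x)"
  shows "\<exists>F \<subseteq> paths G. finite F \<and> cyl x - cyl (pcomp x (d, p, pdom x)) = \<Union>(cyl ` F)"
  using assms(2)
proof (induction p arbitrary: d)
  case Nil
  have "pcomp x (d, [], pdom x) = x" using Nil by (cases x) (simp add: awalk_Nil_iff)
  then show ?case by (intro exI[of _ "{}"]) simp
next
  case (Cons a p)
  let ?z = "(head G a, p, pdom x)"
  let ?y = "pcomp x ?z"
  have a: "a \<in> arcs G" "d = tail G a" "awalk (head G a) p (pdom x)"
    using Cons.prems by (simp_all add: awalk_Cons_iff)
  from Cons.IH[OF a(3)] obtain F
    where F: "F \<subseteq> paths G" "finite F" "cyl x - cyl ?y = \<Union>(cyl ` F)" by blast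
  have z: "?z \<in> paths G" using a by (simp add: paths_def)
  have y: "?y \<in> paths G" "pdom ?y = head G a" using z assms(1) by (simp_all add: pcomp_in_paths)
  have eq: "pcomp x (d, a # p, pdom x) = pcomp ?y (arc_path G a)"
    using a by (cases x) (simp add: arc_path_def)
  let ?B = "(\<lambda>b. pcomp ?y (arc_path G b)) ` (in_arcs G (head G a) - {a})"
  have "cyl (pcomp ?y (arc_path G a)) \<subseteq> cyl ?y" "cyl ?y \<subseteq> cyl x"
    using a y z assms(1) by (intro cyl_pcomp_subset; simp add: arc_path_in_paths)+
  then have "cyl x - cyl (pcomp x (d, a # p, pdom x)) =
      (cyl x - cyl ?y) \<union> (cyl ?y - cyl (pcomp ?y (arc_path G a)))"
    unfolding eq by blast
  also have "\<dots> = \<Union>(cyl ` (F \<union> ?B))"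
    using F(3) cyl_diff_arc[OF y(1) a(1)] y(2) by (simp add: image_Un image_image)
  finally have "cyl x - cyl (pcomp x (d, a # p, pdom x)) = \<Union>(cyl ` (F \<union> ?B))" .
  moreover have "?B \<subseteq> paths G"
  proof
    fix t assume "t \<in> ?B"
    then obtain b where "b \<in> in_arcs G (head G a)" "t = pcomp ?y (arc_path G b)" by blast
    then show "t \<in> paths G" using y by (simp add: pcomp_in_paths arc_path_in_paths)
  qed
  \<comment> \<open>The only place where finiteness of the in-degrees enters.\<close>
  moreover have "finite ?B" using finite_in_arcs[of "head G a"] a by simp
  ultimately show ?case using F by (intro exI[of _ "F \<union> ?B"]) simp
qed

text \<open>One boundary ray suffices: its two images agree as rays and as integers, so x and y have
  equal length and therefore coincide.\<close>

lemma sub_identity_cases: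
  assumes "e \<in> carrier (graph_inverse_semigroup G)" "ray_rel (boundary_rays G) e \<subseteq> Id"
  obtains "e = Null" | x where "e = Frac x x" "x \<in> paths G"
proof (cases e)
  case (Frac x y)
  then have xy: "is_frac G x y" using assms(1) by (simp add: carrier_gis)
  obtain w where w: "w \<in> boundary_rays G" "fst w = pdom x"
    using B.ray_exists[OF pdom_in_verts[of x]] xy by blast
  then have "((path_act x w, 0 + int (plen x)), (path_act y w, 0 + int (plen y))) \<in> ray_rel (boundary_rays G) e"
    unfolding Frac by (intro ray_relI) simp_all
  then have "path_act x w = path_act y w" "plen x = plen y" using assms(2) by auto
  then have "x = y" using xy by (intro path_act_eq_length) simp_all
  then show thesis using that(2) Frac xy by simp
qed (use that(1) in simp)

theorem pre_boolean_graph_inverse_semigroup: "pre_boolean (graph_inverse_semigroup G)"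
proof -
  interpret T: tight_rep "graph_inverse_semigroup G" "ray_rel UNIV" "ray_rel (boundary_rays G)"
    by (rule tight_ray_rep)
  let ?E = "{e \<in> carrier (graph_inverse_semigroup G). ray_rel (boundary_rays G) e \<subseteq> Id}"
  let ?r = "ray_rel (boundary_rays G)"
  have Frac_E: "Frac x x \<in> ?E" if "x \<in> paths G" for x
    using that cyl_subset_Id by (simp add: carrier_gis del: split_paired_Ex)
  show ?thesis
  proof (rule T.pre_booleanI)
    fix e f assume e: "e \<in> ?E" and f: "f \<in> ?E"
    \<comment> \<open>Two cylinders are disjoint or nested; only when that of f lies inside that of
      e does the difference need to be cut into pieces.\<close>
    consider (empty) "?r e \<subseteq> ?r f" | (disjoint) "?r e \<inter> ?r f = {}"
      | (cyl) x z where "x \<in> paths G" "z \<in> paths G" "pdom x = pcod z"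
          "e = Frac x x" "f = Frac (pcomp x z) (pcomp x z)"
    proof (cases "?r e \<inter> ?r f = {}")
      case False
      then have "e \<noteq> Null" "f \<noteq> Null" by auto
      then obtain x u where eqs: "e = Frac x x" "f = Frac u u" and xu: "x \<in> paths G" "u \<in> paths G"
        using e f by (metis (no_types, lifting) mem_Collect_eq sub_identity_cases)
      have "is_frac G x x" "is_frac G u u" using xu by simp_all
      from this False[unfolded eqs] show thesis
      proof (cases rule: B.ray_rel_meets)
        case (1 z)
        then show thesis using that(3)[of x z] xu by (simp add: eqs)
      next
        case (2 z)
        then show thesis using that(1) cyl_pcomp_subset[of u z] xu by (simp add: eqs)
      qed
    qed (use that(2) in blast)
    then show "\<exists>F \<subseteq> ?E. finite F \<and> ?r e - ?r f = \<Union>(?r ` F)"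
    proof cases
      case empty
      then show ?thesis by (intro exI[of _ "{}"]) simp
    next
      case disjoint
      then show ?thesis using e by (intro exI[of _ "{e}"]) (simp add: Diff_triv)
    next
      case (cyl x z)
      have z: "z = (pdom z, fst (snd z), pdom x)" "awalk (pdom z) (fst (snd z)) (pdom x)"
        using cyl by (cases z; simp add: paths_def)+
      obtain F where F: "F \<subseteq> paths G" "finite F" "cyl x - cyl (pcomp x z) = \<Union>(cyl ` F)"
        using cyl_diff_pcomp[OF cyl(1) z(2)] unfolding z(1)[symmetric] by blast
      have "(\<lambda>x. Frac x x) ` F \<subseteq> ?E" using Frac_E[OF subsetD[OF F(1)]] by (rule image_subsetI)
      then show ?thesis
        unfolding cyl(4,5) using F(2,3)
        by (intro exI[of _ "(\<lambda>x. Frac x x) ` F"] conjI) (simp_all add: image_image)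
    qed
  qed
qed

end

theorem theorem4p10:
  fixes G :: "('v, 'e) pre_digraph"
  assumes "wf_digraph G"
    and "\<And>v. v \<in> verts G \<Longrightarrow> finite (in_arcs G v)"
  shows "pre_boolean (graph_inverse_semigroup G)"
proof -
  interpret finite_in_degree_digraph G
    using assms by (simp add: finite_in_degree_digraph_def finite_in_degree_digraph_axioms_def)
  show ?thesis by (rule pre_boolean_graph_inverse_semigroup)
qed

end
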